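(* Let $S\ge 2$ and $N=K\ge 2$ be integers, and consider the cache-aided multi-user private information retrieval problem with $S$ databases, $N$ files and $K$ users, each with a cache of size $ML$ bits where $M=\frac{NS^{N-1}-q}{KS^{N-1}}$, in which all $K$ users have distinct demands. The proposed scheme (described in the context) achieves the rate $$R=\frac{q}{S^{N-1}},$$ i.e., every user $u\in[K]$ can recover its demanded file $W_{d_u}$ from the answers of all databases together with its own cache content, and the total number $D$ of bits transmitted by all databases satisfies $D/L=q/S^{N-1}$.
   Context: Notation: $[n]=\{1,\dots,n\}$; $\oplus$ and sums are bitwise XOR. Problem. There are $S$ non-colluding databases, each storing the same $N$ files $W_1,\dots,W_N$ of $L$ bits each, and $K$ users, each with a cache of $ML$ bits. Caches are filled (placement phase) before the demands are known. Then user $u$ demands $W_{d_u}$, $d_u\in[N]$; the demand vector is $\theta=(d_1,\dots,d_K)$. The users cooperatively generate a query set $Q_s$ for each database $s\in[S]$; database $s$ replies with the answers $A_s$, received by all users. With $D$ the total number of bits transmitted by the databases in the delivery phase, the rate is $R=D/L$. Parameters. For $k\in[N]$: $g(S,k)=\frac{S-1}{S}[(-1)^{k-1}+(S-1)^{k-2}]$, $f(S,k)=\frac1S[(-1)^k+(S-1)^{k-1}]$; $\phi_1(S,k)=g(S,k)$ and $\phi_s(S,k)=f(S,k)$ for $2\le s\le S$; $\psi_s(S,k)=\left\lceil\frac{k(N-1)}{N}\phi_s(S,k)\right\rceil$; $q=\sum_{k=1}^N\sum_{s=1}^S\binom Nk\psi_s(S,k)$; $H=q-(N-1)S^{N-1}$.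 For $i,d\in[N]$: $\mathcal F_s^{i,d}(k)=\binom{N-1}{k-1}\phi_s(S,k)$ if $i\ne d$, and $\mathcal F_s^{d,d}(k)=\binom Nk\psi_s(S,k)-(N-1)\binom{N-1}{k-1}\phi_s(S,k)$. Subpacketization. $L$ is a multiple of $KS^{N-1}$. Each file $W_i$ is divided into $K$ equal subfiles $W_{i,1},\dots,W_{i,K}$, and each $W_{i,j}$ into $S^{N-1}$ equal subsubfiles $W_{i,j}^1,\dots,W_{i,j}^{S^{N-1}}$. Placement. A database broadcasts $Z=\{W_{1,j}^t\oplus\cdots\oplus W_{N,j}^t: j\in[K],\ H+1\le t\le S^{N-1}\}$. The users cooperatively generate a random permutation $(p_1,\dots,p_K)$ of $[K]$ (unknown to the databases), and user $u$ stores $Z_u=\{W_{1,p_u}^t\oplus\cdots\oplus W_{N,p_u}^t: H+1\le t\le S^{N-1}\}$. Procedure QSet1$(j;a^1,\dots,a^N;d)$, with $j\in[K]$, $d\in[N]$, and $a^i=(a^i_1,\dots,a^i_{S^{N-1}})$ permutations of $[S^{N-1}]$. Queries are sets of subsubfiles $W_{i,j}^x$ with distinct $i$; a query with $k$ elements is a $k$-sum. Initialize $Q'_1=\{\{W_{i,j}^{a^i_1}\}:i\in[N]\}$, $Q'_s=\emptyset$ for $s\ge2$, $t_i=1$ for all $i$. For $k=2,\dots,N$: set $T_i=t_i$ for all $i$; for $s=1,\dots,S$: let $\mathcal C$ be the multiset containing every $k$-subset of $[N]$ exactly $\psi_s(S,k)$ times and $\mathcal T=\emptyset$; for $i=1,\dots,N$,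 repeat $\mathcal F_s^{i,d}(k)$ times the following step. (a) If some $U\in\mathcal C$ contains $i$: increase $t_i$ by one, add to $Q'_s$ the query consisting of $W_{i,j}^{a^i_{t_i}}$ and, for every $u\in U\setminus\{i\}$, some $W_{u,j}^{a^u_{\tau}}$ with $\tau\le T_u$; move $U$ from $\mathcal C$ to $\mathcal T$. (b) Otherwise: choose $U\in\mathcal C$, $V\in\mathcal T$ with corresponding query $q'=\{W_{v,j}^{a^v_{t'_v}}:v\in V\}\in Q'_s$, and $v_1\in U\cap V$, such that $i\in V$ and $t'_{v_1}>T_{v_1}$; add to $Q'_s$ the query consisting of $W_{v_1,j}^{a^{v_1}_{t'_{v_1}}}$ and, for every $u\in U\setminus\{v_1\}$, some $W_{u,j}^{a^u_\tau}$ with $\tau\le T_u$; increase $t_i$ by one; in $q'$ replace the subsubfile of $W_{i,j}$ by $W_{i,j}^{a^i_{t_i}}$ and that of $W_{v_1,j}$ by some $W_{v_1,j}^{a^{v_1}_\tau}$ with $\tau\le T_{v_1}$; move $U$ from $\mathcal C$ to $\mathcal T$. The indices $\tau$ are chosen so as to maintain symmetry in the repetition of subsubfiles of every subfile $W_{i,j}$, $i\in[N]$, in the query sets $Q'_s$. The output is $Q'_1,\dots,Q'_S$. Delivery ($N=K$, distinct demands). For each $c\in[K]$ the users generate random permutations $P^{c1},\dots,P^{cN}$ of $[S^{N-1}]$ such that the entries of $P^{cd_c}$ in positions $H+1,\dots,S^{N-1}$ are $H+1,\dots,S^{N-1}$ in this order, and run QSet1$(p_c;P^{c1},\dots,P^{cN};d_c)$;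 let $Q^c_s$ be the collection of the XOR-sums of the elements of each query in the output $Q'_s$. The query set for database $s$ is $Q_s=\bigcup_{c=1}^K Q^c_s$; the answer to each query is the requested sum, which has the size of one subsubfile ($L/(KS^{N-1})$ bits). *)

theory Defs
  imports
    Complex_Main
    "HOL-Library.Multiset"
    "HOL-Library.FuncSet"
    "HOL-Library.Z2"
    "HOL-Combinatorics.Permutations"
begin

definition g_par :: "nat \<Rightarrow> nat \<Rightarrow> real" where
  "g_par S k = (real S - 1) / real S * ((-1) powi (int k - 1) + (real S - 1) powi (int k - 2))"

definition f_par :: "nat \<Rightarrow> nat \<Rightarrow> real" where
  "f_par S k = 1 / real S * ((-1) ^ k + (real S - 1) powi (int k - 1))"

definition phi :: "nat \<Rightarrow> nat \<Rightarrow> nat \<Rightarrow> real" where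
  "phi S s k = (if s = 1 then g_par S k else f_par S k)"

definition psi :: "nat \<Rightarrow> nat \<Rightarrow> nat \<Rightarrow> nat \<Rightarrow> nat" where
  "psi N S s k = nat \<lceil>real k * (real N - 1) / real N * phi S s k\<rceil>"

definition num_queries :: "nat \<Rightarrow> nat \<Rightarrow> nat" where
  "num_queries N S = (\<Sum>k = 1..N. \<Sum>s = 1..S. (N choose k) * psi N S s k)"

text \<open>The subtraction below does not truncate: rounding up in \<^const>\<open>psi\<close> gives
  \<open>num_queries N S \<ge> (N - 1) * S ^ (N - 1)\<close>.\<close>

definition H_par :: "nat \<Rightarrow> nat \<Rightarrow> nat" where
  "H_par N S = num_queries N S - (N - 1) * S ^ (N - 1)"

text \<open>For \<open>1 \<le> k \<le> N\<close> both expressions under the floor are nonnegative integers; the floor only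
  turns them into a number of loop iterations.\<close>

definition fresh_count :: "nat \<Rightarrow> nat \<Rightarrow> nat \<Rightarrow> nat \<Rightarrow> nat \<Rightarrow> nat \<Rightarrow> nat" where
  "fresh_count N S s i d k =
     (if i \<noteq> d
      then nat \<lfloor>real ((N - 1) choose (k - 1)) * phi S s k\<rfloor>
      else nat \<lfloor>real (N choose k) * real (psi N S s k)
                - (real N - 1) * real ((N - 1) choose (k - 1)) * phi S s k\<rfloor>)"

text \<open>A triple \<open>(i, j, t)\<close> names the subsubfile \<open>t\<close> of subfile \<open>j\<close> of file \<open>i\<close>, all indices
  starting at 1.  A set of such triples stands for the formal XOR of its elements.\<close>

type_synonym symbol = "nat \<times> nat \<times> nat"

definition block_size :: "nat \<Rightarrow> nat \<Rightarrow> nat \<Rightarrow> nat \<Rightarrow> nat" where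
  "block_size N S K L = L div (K * S ^ (N - 1))"

definition subsubfile ::
  "nat \<Rightarrow> nat \<Rightarrow> nat \<Rightarrow> nat \<Rightarrow> (nat \<Rightarrow> bit list) \<Rightarrow> symbol \<Rightarrow> bit list" where
  "subsubfile N S K L W = (\<lambda>(i, j, t).
     take (block_size N S K L)
       (drop (((j - 1) * S ^ (N - 1) + (t - 1)) * block_size N S K L) (W i)))"

definition xor_sum ::
  "nat \<Rightarrow> nat \<Rightarrow> nat \<Rightarrow> nat \<Rightarrow> (nat \<Rightarrow> bit list) \<Rightarrow> symbol set \<Rightarrow> bit list" where
  "xor_sum N S K L W x =
     map (\<lambda>b. \<Sum>y\<in>x. subsubfile N S K L W y ! b) [0..<block_size N S K L]"

definition file_sum :: "nat \<Rightarrow> nat \<Rightarrow> nat \<Rightarrow> symbol set" where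
  "file_sum N j t = {(i, j, t) | i. i \<in> {1..N}}"

definition broadcast :: "nat \<Rightarrow> nat \<Rightarrow> nat \<Rightarrow> symbol set set" where
  "broadcast N S K =
     {file_sum N j t | j t. j \<in> {1..K} \<and> t \<in> {H_par N S + 1..S ^ (N - 1)}}"

definition cached :: "nat \<Rightarrow> nat \<Rightarrow> nat \<Rightarrow> (nat \<Rightarrow> nat) \<Rightarrow> nat \<Rightarrow> symbol set set" where
  "cached N S K p u = {x \<in> broadcast N S K. \<exists>t. x = file_sum N (p u) t}"

text \<open>While the query sets are being built, a pair \<open>(i, \<tau>)\<close> stands for the subsubfile of
  \<open>W\<^bsub>i,j\<^esub>\<close> whose number is the entry of \<open>a\<^sup>i\<close> at position \<open>\<tau>\<close>; positions are replaced by
  the entries of the permutations only in the output.  A state consists of the query sets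
  \<open>Q'\<^sub>s\<close>, the counters \<open>t\<^sub>i\<close>, and the multisets \<open>\<C>\<close> and \<open>\<T>\<close>.\<close>

type_synonym pos_query = "(nat \<times> nat) set"

type_synonym qstate =
  "(nat \<Rightarrow> pos_query set) \<times> (nat \<Rightarrow> nat) \<times> nat set multiset \<times> nat set multiset"

text \<open>The repeated (non-fresh) positions \<open>\<tau>\<close> are chosen by a rule that sees the bounds \<open>T\<^sub>u\<close>, the
  whole current state, the chosen set \<open>U\<close> and the file \<open>u\<close>.  No state occurs twice in a run of
  the procedure, so every possible way of choosing the positions is described by some rule; a
  choice that keeps the repetitions symmetric is one instance.\<close>

type_synonym tau_choice = "(nat \<Rightarrow> nat) \<Rightarrow> qstate \<Rightarrow> nat set \<Rightarrow> nat \<Rightarrow> nat"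

definition tau_rule :: "tau_choice \<Rightarrow> bool" where
  "tau_rule tau \<longleftrightarrow> (\<forall>T st U u. 1 \<le> T u \<longrightarrow> tau T st U u \<in> {1..T u})"

inductive qstep :: "tau_choice \<Rightarrow> (nat \<Rightarrow> nat) \<Rightarrow> nat \<Rightarrow> nat \<Rightarrow> qstate \<Rightarrow> qstate \<Rightarrow> bool"
  for tau :: tau_choice and T :: "nat \<Rightarrow> nat" and s :: nat and i :: nat
where
  step_a:
    "\<lbrakk>U \<in># \<C>; i \<in> U;
      new = insert (i, t i + 1) {(u, tau T (Q, t, \<C>, \<T>) U u) | u. u \<in> U - {i}}\<rbrakk>
     \<Longrightarrow> qstep tau T s i (Q, t, \<C>, \<T>)
           (Q(s := insert new (Q s)), t(i := t i + 1), \<C> - {#U#}, add_mset U \<T>)"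
| step_b:
    "\<lbrakk>\<forall>U'. U' \<in># \<C> \<longrightarrow> i \<notin> U';
      U \<in># \<C>; V \<in># \<T>; q' \<in> Q s; fst ` q' = V; v1 \<in> U \<inter> V; i \<in> V;
      (v1, x) \<in> q'; T v1 < x;
      new = insert (v1, x) {(u, tau T (Q, t, \<C>, \<T>) U u) | u. u \<in> U - {v1}};
      q'' = {(v, y). (v, y) \<in> q' \<and> v \<noteq> i \<and> v \<noteq> v1}
              \<union> {(i, t i + 1), (v1, tau T (Q, t, \<C>, \<T>) U v1)}\<rbrakk>
     \<Longrightarrow> qstep tau T s i (Q, t, \<C>, \<T>)
           (Q(s := insert new (insert q'' (Q s - {q'}))), t(i := t i + 1),
            \<C> - {#U#}, add_mset U \<T>)"

primrec for_loop :: "('b \<Rightarrow> 'a \<Rightarrow> 'a \<Rightarrow> bool) \<Rightarrow> 'b list \<Rightarrow> 'a \<Rightarrow> 'a \<Rightarrow> bool" where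
  "for_loop R [] = (=)"
| "for_loop R (x # xs) = R x OO for_loop R xs"

definition qblock ::
  "nat \<Rightarrow> nat \<Rightarrow> tau_choice \<Rightarrow> nat \<Rightarrow> nat \<Rightarrow> (nat \<Rightarrow> nat) \<Rightarrow> nat \<Rightarrow>
   (nat \<Rightarrow> pos_query set) \<times> (nat \<Rightarrow> nat) \<Rightarrow> (nat \<Rightarrow> pos_query set) \<times> (nat \<Rightarrow> nat) \<Rightarrow> bool" where
  "qblock N S tau d k T s = (\<lambda>(Q, t) (Q', t'). \<exists>\<C>' \<T>'.
     for_loop (\<lambda>i. qstep tau T s i ^^ fresh_count N S s i d k) [1..<N + 1]
       (Q, t, repeat_mset (psi N S s k) (mset_set {U. U \<subseteq> {1..N} \<and> card U = k}), {#})
       (Q', t', \<C>', \<T>'))"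

definition qround ::
  "nat \<Rightarrow> nat \<Rightarrow> tau_choice \<Rightarrow> nat \<Rightarrow> nat \<Rightarrow>
   (nat \<Rightarrow> pos_query set) \<times> (nat \<Rightarrow> nat) \<Rightarrow> (nat \<Rightarrow> pos_query set) \<times> (nat \<Rightarrow> nat) \<Rightarrow> bool" where
  "qround N S tau d k = (\<lambda>(Q, t). for_loop (qblock N S tau d k t) [1..<S + 1] (Q, t))"

definition qinit :: "nat \<Rightarrow> (nat \<Rightarrow> pos_query set) \<times> (nat \<Rightarrow> nat)" where
  "qinit N = ((\<lambda>s. if s = 1 then {{(i, 1)} | i. i \<in> {1..N}} else {}), (\<lambda>i. 1))"

text \<open>The set of all possible outputs, one for each way to complete the procedure.\<close>

definition QSet1 ::
  "nat \<Rightarrow> nat \<Rightarrow> tau_choice \<Rightarrow> nat \<Rightarrow> (nat \<Rightarrow> nat \<Rightarrow> nat) \<Rightarrow> nat \<Rightarrow>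
   (nat \<Rightarrow> symbol set set) set" where
  "QSet1 N S tau j a d =
     {(\<lambda>s. (\<lambda>q. (\<lambda>(i, \<tau>). (i, j, a i \<tau>)) ` q) ` Q s) | Q t.
        for_loop (qround N S tau d) [2..<N + 1] (qinit N) (Q, t)}"

text \<open>\<open>P c i\<close> is the permutation \<open>P\<^sup>c\<^sup>i\<close>.\<close>

definition valid_perms ::
  "nat \<Rightarrow> nat \<Rightarrow> nat \<Rightarrow> (nat \<Rightarrow> nat) \<Rightarrow> (nat \<Rightarrow> nat \<Rightarrow> nat \<Rightarrow> nat) \<Rightarrow> bool" where
  "valid_perms N S K d P \<longleftrightarrow>
     (\<forall>c\<in>{1..K}. (\<forall>i\<in>{1..N}. P c i permutes {1..S ^ (N - 1)})
        \<and> (\<forall>t\<in>{H_par N S + 1..S ^ (N - 1)}. P c (d c) t = t))"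

definition delivery ::
  "nat \<Rightarrow> nat \<Rightarrow> nat \<Rightarrow> (nat \<Rightarrow> tau_choice) \<Rightarrow> (nat \<Rightarrow> nat) \<Rightarrow>
   (nat \<Rightarrow> nat \<Rightarrow> nat \<Rightarrow> nat) \<Rightarrow> (nat \<Rightarrow> nat) \<Rightarrow> (nat \<Rightarrow> symbol set set) set" where
  "delivery N S K tau p P d =
     {(\<lambda>s. \<Union>c\<in>{1..K}. Qc c s) | Qc.
        \<forall>c\<in>{1..K}. Qc c \<in> QSet1 N S (tau c) (p c) (P c) (d c)}"

text \<open>The values of a set of formal sums, as a function of the file contents.\<close>

definition contents ::
  "nat \<Rightarrow> nat \<Rightarrow> nat \<Rightarrow> nat \<Rightarrow> symbol set set \<Rightarrow> (nat \<Rightarrow> bit list) \<Rightarrow> symbol set \<Rightarrow> bit list" where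
  "contents N S K L X W = (\<lambda>x\<in>X. xor_sum N S K L W x)"

definition answers ::
  "nat \<Rightarrow> nat \<Rightarrow> nat \<Rightarrow> nat \<Rightarrow> (nat \<Rightarrow> symbol set set) \<Rightarrow> (nat \<Rightarrow> bit list) \<Rightarrow>
   nat \<Rightarrow> symbol set \<Rightarrow> bit list" where
  "answers N S K L Q W = (\<lambda>s\<in>{1..S}. contents N S K L (Q s) W)"

definition cache_bits ::
  "nat \<Rightarrow> nat \<Rightarrow> nat \<Rightarrow> nat \<Rightarrow> (nat \<Rightarrow> nat) \<Rightarrow> (nat \<Rightarrow> bit list) \<Rightarrow> nat \<Rightarrow> nat" where
  "cache_bits N S K L p W u =
     (\<Sum>x\<in>cached N S K p u. length (contents N S K L (cached N S K p u) W x))"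

definition transmitted_bits ::
  "nat \<Rightarrow> nat \<Rightarrow> nat \<Rightarrow> nat \<Rightarrow> (nat \<Rightarrow> symbol set set) \<Rightarrow> (nat \<Rightarrow> bit list) \<Rightarrow> nat" where
  "transmitted_bits N S K L Q W =
     (\<Sum>s = 1..S. \<Sum>x\<in>Q s. length (answers N S K L Q W s x))"

definition files :: "nat \<Rightarrow> nat \<Rightarrow> (nat \<Rightarrow> bit list) set" where
  "files N L = {W. \<forall>i\<in>{1..N}. length (W i) = L}"

end

theory Submission
  imports Defs
begin

text \<open>Every query added in round \<open>k\<close> contains exactly one fresh position, that is, a position
  beyond the counters at the start of the round, and step (b) only redistributes these positions.
  All other symbols of the query are known from earlier rounds, so its answer reveals the fresh
  one.  Counting loop iterations gives the final counters: \<open>S ^ (N - 1)\<close> for each undesired file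
  and \<open>H\<close> for the desired file.  Thus all users learn every subfile \<open>p\<^sub>c\<close> of \<open>W\<^sub>i\<close> for
  \<open>i \<noteq> d\<^sub>c\<close> completely, and the first \<open>H\<close> subsubfiles for \<open>i = d\<^sub>c\<close>; user \<open>c\<close> gets the
  remaining ones by subtracting the undesired files from the cached sums.

  That the procedure can be completed is a question of assigning to each query the file of its fresh
  position with prescribed frequencies.  A symmetric fractional assignment exists, Hall's theorem
  turns it into an integral one, and following it only step (a) is ever executed.\<close>

section \<open>Hall's theorem and integral assignments\<close>

text \<open>Existence and correctness are separate claims: one run has to exist, while every run has
  to decode, including those that use step (b) and any admissible \<open>tau\<close>. The obstacle
  is that step (b) rewrites queries of the running round, so the fresh positions cannot be called
  decodable in the middle of it. Hence the bounds \<open>T\<close> are frozen for a round, only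
  queries below \<open>T\<close> count for decoding, and fresh positions are merely tracked until
  the round closes. The fractional weights are legitimate because \<open>psi\<close> is squeezed
  between \<open>k (N - 1) / N * phi\<close> and the integer \<open>k * phi\<close>: the lower bound
  leaves the demanded file a nonnegative count, the upper one keeps this count within the number of
  sets that contain the file. Query sets are sets, so the bit count also requires that no two
  queries coincide. Inside a run a new fresh position separates the new query from all others, and
  the subfile index separates the \<open>K\<close> runs.\<close>

lemma Rado_remove:
  fixes A :: "'i \<Rightarrow> 'a set"
  assumes fin: "\<And>i. i \<in> I \<Longrightarrow> finite (A i)"
    and hall: "\<And>J. J \<subseteq> I \<Longrightarrow> finite J \<Longrightarrow> card J \<le> card (\<Union>(A ` J))"
    and "i \<in> I" "x \<in> A i" "y \<in> A i" "x \<noteq> y"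
  shows "\<exists>z\<in>{x, y}. \<forall>J \<subseteq> I. finite J \<longrightarrow> card J \<le> card (\<Union>((A(i := A i - {z})) ` J))"
proof (rule ccontr)
  assume "\<not> ?thesis"
  then have ex: "\<exists>J \<subseteq> I. finite J \<and> card (\<Union>((A(i := A i - {z})) ` J)) < card J"
    if "z \<in> {x, y}" for z
    using that by (meson not_le)
  have ex': "\<exists>J \<subseteq> I - {i}. finite J \<and> card ((A i - {z}) \<union> \<Union>(A ` J)) \<le> card J"
    if z: "z \<in> {x, y}" for z
  proof -
    obtain J where J: "J \<subseteq> I" "finite J" "card (\<Union>((A(i := A i - {z})) ` J)) < card J"
      using ex[OF z] by blast
    have "i \<in> J"
    proof (rule ccontr)
      assume "i \<notin> J"
      then have "(A(i := A i - {z})) ` J = A ` J" by (intro image_cong) auto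
      then show False using hall[OF J(1,2)] J(3) by (metis not_le)
    qed
    moreover have "\<Union>((A(i := A i - {z})) ` J) = (A i - {z}) \<union> \<Union>(A ` (J - {i}))"
      using \<open>i \<in> J\<close> by auto
    ultimately show ?thesis
      using J by (intro exI[of _ "J - {i}"]) (auto simp: card_Diff_singleton)
  qed
  obtain J where J: "J \<subseteq> I - {i}" "finite J" "card ((A i - {x}) \<union> \<Union>(A ` J)) \<le> card J"
    using ex'[of x] by blast
  obtain J' where J': "J' \<subseteq> I - {i}" "finite J'" "card ((A i - {y}) \<union> \<Union>(A ` J')) \<le> card J'"
    using ex'[of y] by blast
  \<comment> \<open>Each set loses one element of \<open>A i\<close>, and since
    \<open>x \<noteq> y\<close> their union regains all of it. Hall's condition for
    \<open>insert i (J \<union> J')\<close> and for \<open>J \<inter> J'\<close> then makes the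
    sizes of union and intersection add up to more than \<open>card J + card J'\<close>.\<close>
  let ?X = "(A i - {x}) \<union> \<Union>(A ` J)" and ?Y = "(A i - {y}) \<union> \<Union>(A ` J')"
  have finX: "finite ?X" and finY: "finite ?Y"
    using fin J(1,2) J'(1,2) \<open>i \<in> I\<close> by auto
  have "card (insert i (J \<union> J')) \<le> card (\<Union>(A ` insert i (J \<union> J')))"
    using J J' \<open>i \<in> I\<close> by (intro hall) auto
  also have "\<Union>(A ` insert i (J \<union> J')) = ?X \<union> ?Y"
    using assms(4-6) by auto
  finally have 1: "Suc (card (J \<union> J')) \<le> card (?X \<union> ?Y)"
    using J J' by (subst (asm) card_insert_disjoint) auto
  have "card (J \<inter> J') \<le> card (\<Union>(A ` (J \<inter> J')))"
    using J J' by (intro hall) auto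
  also have "\<dots> \<le> card (?X \<inter> ?Y)"
    using finX by (intro card_mono) auto
  finally have 2: "card (J \<inter> J') \<le> card (?X \<inter> ?Y)" .
  have "card J + card J' = card (J \<union> J') + card (J \<inter> J')"
    using J J' by (intro card_Un_Int) auto
  moreover have "card ?X + card ?Y = card (?X \<union> ?Y) + card (?X \<inter> ?Y)"
    using finX finY by (intro card_Un_Int)
  ultimately show False using 1 2 J(3) J'(3) by linarith
qed

text \<open>Rado's argument: elements are deleted without destroying Hall's condition until all sets
  are singletons, and for singletons the condition on pairs of indices says that they are
  distinct.\<close>

theorem Hall_marriage:
  fixes A :: "'i \<Rightarrow> 'a set"
  assumes "finite I" "\<And>i. i \<in> I \<Longrightarrow> finite (A i)"
    and "\<And>J. J \<subseteq> I \<Longrightarrow> card J \<le> card (\<Union>(A ` J))"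
  shows "\<exists>h. inj_on h I \<and> (\<forall>i\<in>I. h i \<in> A i)"
  using assms
proof (induction "\<Sum>i\<in>I. card (A i)" arbitrary: A rule: less_induct)
  case less
  show ?case
  proof (cases "\<exists>i\<in>I. \<exists>x\<in>A i. \<exists>y\<in>A i. x \<noteq> y")
    case True
    then obtain i x y where ixy: "i \<in> I" "x \<in> A i" "y \<in> A i" "x \<noteq> y" by blast
    obtain z where z: "z \<in> {x, y}"
      and hall: "\<And>J. J \<subseteq> I \<Longrightarrow> card J \<le> card (\<Union>((A(i := A i - {z})) ` J))"
      using Rado_remove[of I A i x y] less.prems ixy by (metis finite_subset)
    have zA: "z \<in> A i" using z ixy by auto
    have "0 < card (A i)" using zA less.prems(2) ixy(1) by (auto simp: card_gt_0_iff)
    then have "(\<Sum>j\<in>I. card ((A(i := A i - {z})) j)) < (\<Sum>j\<in>I. card (A j))"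
      using less.prems(1,2) ixy(1) zA
      by (intro sum_strict_mono_ex1) (auto intro!: bexI[of _ i] psubset_card_mono card_mono)
    then obtain h where "inj_on h I" "\<forall>j\<in>I. h j \<in> (A(i := A i - {z})) j"
      using less.hyps[of "A(i := A i - {z})"] less.prems(1,2) hall by fastforce
    then show ?thesis by (metis Diff_iff fun_upd_apply)
  next
    case False
    have "A i \<noteq> {}" if "i \<in> I" for i
      using less.prems(3)[of "{i}"] that by auto
    then obtain h where h: "\<And>i. i \<in> I \<Longrightarrow> h i \<in> A i"
      using bchoice[of I "\<lambda>i x. x \<in> A i"] by auto
    with False have A: "A i = {h i}" if "i \<in> I" for i using that by blast
    have "inj_on h I"
    proof (rule inj_onI, rule ccontr)
      fix i j assume ij: "i \<in> I" "j \<in> I" "h i = h j" "i \<noteq> j"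
      then show False using less.prems(3)[of "{i, j}"] A[of i] A[of j] by simp
    qed
    with h show ?thesis by blast
  qed
qed

text \<open>A fractional assignment \<open>w\<close> implies Hall's condition for the slots \<open>(i, n)\<close>, \<open>n < F i\<close>.\<close>

lemma integral_assignment:
  fixes w :: "'a \<Rightarrow> 'i \<Rightarrow> real" and F :: "'i \<Rightarrow> nat"
  assumes fin: "finite X" "finite I"
    and nonneg: "\<And>x i. x \<in> X \<Longrightarrow> i \<in> I \<Longrightarrow> 0 \<le> w x i"
    and supp: "\<And>x i. x \<in> X \<Longrightarrow> i \<in> I \<Longrightarrow> w x i \<noteq> 0 \<Longrightarrow> i \<in> B x"
    and row: "\<And>x. x \<in> X \<Longrightarrow> (\<Sum>i\<in>I. w x i) = 1"
    and col: "\<And>i. i \<in> I \<Longrightarrow> (\<Sum>x\<in>X. w x i) = real (F i)"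
  shows "\<exists>h. bij_betw h (SIGMA i:I. {..<F i}) X \<and> (\<forall>i\<in>I. \<forall>n<F i. i \<in> B (h (i, n)))"
proof -
  define A where "A = (\<lambda>(i, n::nat). {x \<in> X. i \<in> B x})"
  let ?I = "SIGMA i:I. {..<F i}"
  have "card J \<le> card (\<Union>(A ` J))" if J: "J \<subseteq> ?I" for J
  proof -
    let ?E = "fst ` J"
    let ?Y = "\<Union>(A ` J)"
    have E: "?E \<subseteq> I" using J by auto
    then have finE: "finite ?E" using fin(2) by (rule finite_subset)
    have Y: "?Y \<subseteq> X" "finite ?Y" using fin(1) by (auto simp: A_def intro: finite_subset)
    have "card J \<le> card (SIGMA i:?E. {..<F i})"
      using J E finE by (intro card_mono finite_SigmaI) force+
    also have "\<dots> = (\<Sum>i\<in>?E. F i)" using finE by (subst card_SigmaI) auto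
    finally have "real (card J) \<le> (\<Sum>i\<in>?E. real (F i))"
      by (metis of_nat_le_iff of_nat_sum)
    \<comment> \<open>All weight in the columns \<open>?E\<close> sits on elements of
      \<open>?Y\<close>, and each of these carries total weight 1.\<close>
    also have "\<dots> = (\<Sum>i\<in>?E. \<Sum>x\<in>X. w x i)" using col E by (intro sum.cong) auto
    also have "\<dots> = (\<Sum>i\<in>?E. \<Sum>x\<in>?Y. w x i)"
    proof (rule sum.cong)
      fix i assume i: "i \<in> ?E"
      show "(\<Sum>x\<in>X. w x i) = (\<Sum>x\<in>?Y. w x i)"
      proof (intro sum.mono_neutral_right fin(1) Y(1) ballI)
        fix x assume x: "x \<in> X - ?Y"
        then have "i \<notin> B x" using i by (force simp: A_def)
        then show "w x i = 0" using supp[of x i] i x E by auto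
      qed
    qed simp
    also have "\<dots> = (\<Sum>x\<in>?Y. \<Sum>i\<in>?E. w x i)" by (rule sum.swap)
    also have "\<dots> \<le> (\<Sum>x\<in>?Y. \<Sum>i\<in>I. w x i)"
    proof (intro sum_mono)
      fix x assume "x \<in> ?Y"
      then have "x \<in> X" using Y(1) by blast
      then show "(\<Sum>i\<in>?E. w x i) \<le> (\<Sum>i\<in>I. w x i)"
        using E nonneg fin(2) by (intro sum_mono2) auto
    qed
    also have "\<dots> = (\<Sum>x\<in>?Y. 1)" using Y row by (intro sum.cong) auto
    finally show ?thesis by simp
  qed
  then obtain h where h: "inj_on h ?I" "\<forall>i\<in>?I. h i \<in> A i"
    using Hall_marriage[of ?I A] fin by (auto simp: A_def)
  \<comment> \<open>Summing all weights by columns and by rows shows that there are as many slots as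
    elements of \<open>X\<close>, so the injection is onto.\<close>
  have "real (card ?I) = (\<Sum>i\<in>I. \<Sum>x\<in>X. w x i)"
    using fin col by (simp add: card_SigmaI)
  also have "\<dots> = (\<Sum>x\<in>X. \<Sum>i\<in>I. w x i)" by (rule sum.swap)
  also have "\<dots> = real (card X)" using row by simp
  finally have "card (h ` ?I) = card X" using h(1) by (simp add: card_image)
  moreover have "h ` ?I \<subseteq> X" using h(2) by (auto simp: A_def)
  ultimately have "h ` ?I = X" using fin(1) by (simp add: card_subset_eq)
  then show ?thesis using h by (auto simp: bij_betw_def A_def)
qed

section \<open>Arithmetic of the parameters\<close>

text \<open>Indices of the form \<open>Suc k\<close> turn the integer exponents into natural ones;
  only \<open>g_par\<close> at 1 keeps a negative exponent and is treated on its own.\<close>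

lemma f_par_Suc: "f_par S (Suc k) = ((-1) ^ Suc k + (real S - 1) ^ k) / real S"
  by (simp add: f_par_def)

lemma g_par_Suc_Suc: "g_par S (Suc (Suc k)) = (real S - 1) * f_par S (Suc k)"
proof -
  have "int (Suc (Suc k)) - 1 = int (Suc k)" "int (Suc (Suc k)) - 2 = int k" by simp_all
  then show ?thesis
    unfolding g_par_def f_par_Suc by (simp only: power_int_of_nat) simp
qed

lemma f_par_1 [simp]: "f_par S (Suc 0) = 0"
  by (simp add: f_par_Suc)

lemma g_par_1:
  assumes "S \<ge> 2"
  shows "g_par S (Suc 0) = 1"
proof -
  have "(real S - 1) * inverse (real S - 1) = 1" using assms by simp
  then show ?thesis using assms
    by (simp add: g_par_def power_int_minus divide_simps)
qed

lemma phi_1: "S \<ge> 2 \<Longrightarrow> phi S s (Suc 0) = (if s = 1 then 1 else 0)"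
  by (simp add: phi_def g_par_1)

text \<open>Two steps at a time the sign stays the same, and
  \<open>(S - 1)^2 - 1 = S (S - 2)\<close> cancels the denominator.\<close>

lemma f_par_Nats:
  assumes "S \<ge> 2"
  shows "f_par S (Suc k) \<in> \<nat>"
proof (induction k rule: induct_nat_012)
  case 1
  show ?case using assms by (auto simp: f_par_Suc)
next
  case (ge2 k)
  have "f_par S (Suc (Suc (Suc k))) = f_par S (Suc k) + (real S - 2) * (real S - 1) ^ k"
    using assms by (simp add: f_par_Suc field_simps)
  also have "\<dots> = f_par S (Suc k) + real ((S - 2) * (S - 1) ^ k)"
    using assms by (simp add: of_nat_diff)
  also have "\<dots> \<in> \<nat>" using ge2 by (intro Nats_add of_nat_in_Nats)
  finally show ?case .
qed simp

lemma phi_Nats: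
  assumes "S \<ge> 2" "k \<ge> 1"
  shows "phi S s k \<in> \<nat>"
proof -
  have "real S - 1 = real (S - 1)" using assms by simp
  then have "g_par S (Suc (Suc k)) \<in> \<nat>" for k
    using f_par_Nats[OF assms(1)] by (metis Nats_mult g_par_Suc_Suc of_nat_in_Nats)
  moreover have "g_par S (Suc 0) \<in> \<nat>" using assms(1) by (simp add: g_par_1)
  ultimately have "g_par S k \<in> \<nat>"
    using assms(2) by (metis One_nat_def Suc_le_D not0_implies_Suc)
  moreover have "f_par S k \<in> \<nat>"
    using f_par_Nats[OF assms(1)] assms(2) by (metis One_nat_def Suc_le_D)
  ultimately show ?thesis by (simp add: phi_def)
qed

text \<open>For \<open>S \<ge> 2\<close> and \<open>k \<ge> 1\<close> this loses nothing, as
  \<open>phi\<close> is a natural number there; it keeps the counting arguments inside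
  \<open>nat\<close>.\<close>

definition phi_nat :: "nat \<Rightarrow> nat \<Rightarrow> nat \<Rightarrow> nat" where
  "phi_nat S s k = nat \<lfloor>phi S s k\<rfloor>"

lemma phi_eq: "S \<ge> 2 \<Longrightarrow> k \<ge> 1 \<Longrightarrow> phi S s k = real (phi_nat S s k)"
  using phi_Nats[of S k s] by (auto simp: phi_nat_def elim!: Nats_cases)

text \<open>For \<open>k > 0\<close> database 1 contributes \<open>S - 1\<close> times
  \<open>f_par\<close> at the previous index and the others together \<open>S - 1\<close> times
  \<open>f_par\<close> itself; the alternating signs cancel.\<close>

lemma sum_phi:
  assumes "S \<ge> 2"
  shows "(\<Sum>s = 1..S. phi S s (Suc k)) = (real S - 1) ^ k"
proof -
  have "(\<Sum>s = 1..S. phi S s (Suc k)) = phi S 1 (Suc k) + (\<Sum>s = 2..S. phi S s (Suc k))"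
    using assms by (simp add: sum.atLeast_Suc_atMost numeral_2_eq_2)
  also have "(\<Sum>s = 2..S. phi S s (Suc k)) = (\<Sum>s = 2..S. f_par S (Suc k))"
    by (intro sum.cong) (auto simp: phi_def)
  also have "\<dots> = (real S - 1) * f_par S (Suc k)"
    using assms by (simp add: of_nat_diff)
  also have "phi S 1 (Suc k) + \<dots> = (real S - 1) ^ k"
  proof (cases k)
    case 0
    then show ?thesis using assms by (simp add: phi_def g_par_1)
  next
    case (Suc k')
    then show ?thesis using assms
      by (simp add: phi_def g_par_Suc_Suc f_par_Suc divide_simps) (simp add: algebra_simps)
  qed
  finally show ?thesis .
qed

lemma sum_phi_nat:
  assumes "S \<ge> 2" "k \<ge> 1"
  shows "(\<Sum>s = 1..S. phi_nat S s k) = (S - 1) ^ (k - 1)"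
proof -
  have "real (\<Sum>s = 1..S. phi_nat S s k) = (\<Sum>s = 1..S. phi S s k)"
    using assms by (simp add: phi_eq)
  also have "\<dots> = real ((S - 1) ^ (k - 1))"
    using sum_phi[OF assms(1), of "k - 1"] assms by (simp add: of_nat_diff)
  finally show ?thesis by (simp only: of_nat_eq_iff)
qed

text \<open>The binomial theorem for \<open>((S - 1) + 1) ^ (N - 1)\<close>. This is the origin of
  the number of subsubfiles: it is how often an undesired file is fresh in one run, the initial
  query included.\<close>

lemma sum_choose_phi_nat:
  assumes "S \<ge> 2" "N \<ge> 1"
  shows "(\<Sum>k = 1..N. \<Sum>s = 1..S. (N - 1 choose (k - 1)) * phi_nat S s k) = S ^ (N - 1)"
proof -
  have "(\<Sum>k = 1..N. \<Sum>s = 1..S. (N - 1 choose (k - 1)) * phi_nat S s k) =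
      (\<Sum>k = 1..N. (N - 1 choose (k - 1)) * (S - 1) ^ (k - 1))"
    using assms sum_phi_nat by (intro sum.cong) (auto simp flip: sum_distrib_left)
  also have "\<dots> = (\<Sum>k\<le>N - 1. (N - 1 choose k) * (S - 1) ^ k)"
    using assms(2) by (intro sum.reindex_bij_witness[of _ Suc "\<lambda>k. k - 1"]) auto
  also have "\<dots> = ((S - 1) + 1) ^ (N - 1)" by (subst binomial) simp
  finally show ?thesis using assms(1) by simp
qed

section \<open>Rounding bounds for \<open>psi\<close>, loop counts and the total number of
  queries\<close>

text \<open>Rounding up cannot pass \<open>k * phi\<close>, because that number is an integer. The
  bound limits the demanded file's count and gives \<open>H_par \<le> S ^ (N - 1)\<close>.\<close>

lemma psi_upper:
  assumes "S \<ge> 2" "k \<ge> 1"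
  shows "psi N S s k \<le> k * phi_nat S s k"
proof -
  have "real k * (real N - 1) / real N * phi S s k \<le> real k * phi S s k"
    using assms by (intro mult_right_mono) (auto simp: divide_simps phi_eq)
  also have "\<dots> = real (k * phi_nat S s k)" using assms by (simp add: phi_eq)
  finally show ?thesis unfolding psi_def
    by (metis ceiling_le_iff ceiling_mono ceiling_of_nat nat_int nat_mono)
qed

lemma psi_lower:
  assumes "S \<ge> 2" "k \<ge> 1" "N \<ge> 1"
  shows "k * (N - 1) * phi_nat S s k \<le> N * psi N S s k"
proof -
  have "real k * (real N - 1) / real N * phi S s k \<le> real (psi N S s k)"
    unfolding psi_def by (rule of_nat_ceiling)
  then have "real (k * (N - 1) * phi_nat S s k) \<le> real (N * psi N S s k)"
    using assms by (simp add: phi_eq divide_simps of_nat_diff mult_ac)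
  then show ?thesis by (simp only: of_nat_le_iff)
qed

text \<open>The ceiling lifts \<open>(N - 1) / N\<close> to 1, so the formal terms with
  \<open>k = 1\<close> agree with the initialization: one query per file, at database 1
  only.\<close>

lemma psi_1: "S \<ge> 2 \<Longrightarrow> N \<ge> 2 \<Longrightarrow> psi N S s (Suc 0) = (if s = 1 then 1 else 0)"
proof -
  assume "S \<ge> 2" "N \<ge> 2"
  moreover from \<open>N \<ge> 2\<close> have "\<lceil>(real N - 1) / real N\<rceil> = 1"
    by (simp add: ceiling_eq_iff divide_simps)
  ultimately show ?thesis by (simp add: psi_def phi_1)
qed

lemma times_choose: "1 \<le> k \<Longrightarrow> 1 \<le> N \<Longrightarrow> k * (N choose k) = N * (N - 1 choose (k - 1))"
  using Suc_times_binomial_eq[of "N - 1" "k - 1"] by (simp add: mult.commute)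

lemma choose_psi_lower:
  assumes "S \<ge> 2" "k \<ge> 1" "N \<ge> 1"
  shows "(N - 1) * ((N - 1 choose (k - 1)) * phi_nat S s k) \<le> (N choose k) * psi N S s k"
proof -
  have "k * (N * ((N - 1) * ((N - 1 choose (k - 1)) * phi_nat S s k)))
      = k * (N choose k) * (k * (N - 1) * phi_nat S s k)"
    using times_choose[of k N] assms by simp
  also have "\<dots> \<le> k * (N choose k) * (N * psi N S s k)"
    using psi_lower[OF assms] by (rule mult_left_mono) simp
  also have "\<dots> = k * (N * ((N choose k) * psi N S s k))" by simp
  finally show ?thesis using assms by simp
qed

lemma fresh_count_neq:
  assumes "S \<ge> 2" "k \<ge> 1" "i \<noteq> d"
  shows "fresh_count N S s i d k = (N - 1 choose (k - 1)) * phi_nat S s k"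
  using assms by (simp add: fresh_count_def phi_eq flip: of_nat_mult)

text \<open>Stated as an addition to avoid truncated subtraction; \<open>choose_psi_lower\<close>
  makes the difference under the floor a natural number.\<close>

lemma fresh_count_eq:
  assumes "S \<ge> 2" "k \<ge> 1" "N \<ge> 1"
  shows "fresh_count N S s d d k + (N - 1) * ((N - 1 choose (k - 1)) * phi_nat S s k)
    = (N choose k) * psi N S s k"
proof -
  have "real (N choose k) * real (psi N S s k)
      - (real N - 1) * real ((N - 1) choose (k - 1)) * phi S s k
      = real ((N choose k) * psi N S s k - (N - 1) * ((N - 1 choose (k - 1)) * phi_nat S s k))"
    using choose_psi_lower[OF assms] assms by (simp add: of_nat_diff phi_eq)
  then have "fresh_count N S s d d k
      = (N choose k) * psi N S s k - (N - 1) * ((N - 1 choose (k - 1)) * phi_nat S s k)"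
    unfolding fresh_count_def by (simp only: floor_of_nat nat_int if_False) simp
  then show ?thesis using choose_psi_lower[OF assms] by simp
qed

text \<open>The right-hand side counts the members of the multiset, with copies, that contain
  \<open>d\<close>. After multiplication by \<open>k\<close> the claim follows from
  \<open>psi \<le> k * phi\<close> and \<open>N - k \<le> N - 1\<close>.\<close>

lemma fresh_count_demand_le:
  assumes "S \<ge> 2" "k \<ge> 1" "k \<le> N"
  shows "fresh_count N S s d d k \<le> (N - 1 choose (k - 1)) * psi N S s k"
proof -
  let ?F = "fresh_count N S s d d k" and ?c = "N - 1 choose (k - 1)"
  have "k * ?F + (N - 1) * (?c * (k * phi_nat S s k)) = k * (N choose k) * psi N S s k"
    using fresh_count_eq[of S k N s d, symmetric] assms by (simp add: algebra_simps)
  also have "\<dots> = N * ?c * psi N S s k"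
    using times_choose[of k N] assms by simp
  also have "\<dots> = (N - k) * (?c * psi N S s k) + k * (?c * psi N S s k)"
    using assms by (simp flip: add_mult_distrib)
  also have "(N - k) * (?c * psi N S s k) \<le> (N - 1) * (?c * (k * phi_nat S s k))"
    using assms psi_upper by (intro mult_mono) auto
  finally show ?thesis using assms by simp
qed

text \<open>The iterations of a block are as many as the sets in its multiset, so the block uses
  them up exactly; it is also the number of queries a block adds.\<close>

lemma sum_fresh_count:
  assumes "S \<ge> 2" "k \<ge> 1" "N \<ge> 1" "d \<in> {1..N}"
  shows "(\<Sum>i = 1..N. fresh_count N S s i d k) = (N choose k) * psi N S s k"
proof -
  have "(\<Sum>i = 1..N. fresh_count N S s i d k)
      = fresh_count N S s d d k + (\<Sum>i\<in>{1..N} - {d}. fresh_count N S s i d k)"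
    using assms by (simp add: sum.remove)
  also have "(\<Sum>i\<in>{1..N} - {d}. fresh_count N S s i d k)
      = (N - 1) * ((N - 1 choose (k - 1)) * phi_nat S s k)"
    using assms by (simp add: fresh_count_neq card_Diff_singleton)
  finally show ?thesis using fresh_count_eq[of S k N s d] assms by simp
qed

lemma fresh_count_1:
  assumes "S \<ge> 2" "N \<ge> 2"
  shows "fresh_count N S s i d (Suc 0) = (if s = 1 then 1 else 0)"
  using assms by (auto simp: fresh_count_def phi_1 psi_1)

text \<open>Explains \<open>H_par\<close>: without the share \<open>(N - 1) * S ^ (N - 1)\<close> of
  the undesired files, what remains of the queries is the number of fresh positions of the demanded
  file.\<close>

lemma num_queries_eq:
  assumes "S \<ge> 2" "N \<ge> 1"
  shows "num_queries N S
    = (\<Sum>k = 1..N. \<Sum>s = 1..S. fresh_count N S s d d k) + (N - 1) * S ^ (N - 1)"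
proof -
  have "num_queries N S = (\<Sum>k = 1..N. \<Sum>s = 1..S.
      fresh_count N S s d d k + (N - 1) * ((N - 1 choose (k - 1)) * phi_nat S s k))"
    unfolding num_queries_def using assms fresh_count_eq by (intro sum.cong) auto
  then show ?thesis
    using sum_choose_phi_nat[OF assms] by (simp add: sum.distrib flip: sum_distrib_left)
qed

lemma num_queries_upper:
  assumes "S \<ge> 2" "N \<ge> 1"
  shows "num_queries N S \<le> N * S ^ (N - 1)"
proof -
  have "num_queries N S
      \<le> (\<Sum>k = 1..N. \<Sum>s = 1..S. N * ((N - 1 choose (k - 1)) * phi_nat S s k))"
    unfolding num_queries_def
  proof (intro sum_mono)
    fix k s assume k: "k \<in> {1..N}"
    have "(N choose k) * psi N S s k \<le> (N choose k) * (k * phi_nat S s k)"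
      using psi_upper assms k by (intro mult_left_mono) auto
    also have "\<dots> = k * (N choose k) * phi_nat S s k" by simp
    also have "\<dots> = N * ((N - 1 choose (k - 1)) * phi_nat S s k)"
      using times_choose[of k N] k by simp
    finally show "(N choose k) * psi N S s k \<le> \<dots>" .
  qed
  also have "\<dots> = N * S ^ (N - 1)"
    using sum_choose_phi_nat[OF assms] by (simp flip: sum_distrib_left)
  finally show ?thesis .
qed

lemma num_queries_lower:
  assumes "S \<ge> 2" "N \<ge> 1"
  shows "(N - 1) * S ^ (N - 1) \<le> num_queries N S"
  using num_queries_eq[OF assms, of 1] by simp

lemma H_par_le:
  assumes "S \<ge> 2" "N \<ge> 1"
  shows "H_par N S \<le> S ^ (N - 1)"
proof -
  have "N * S ^ (N - 1) = (N - 1) * S ^ (N - 1) + S ^ (N - 1)"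
    using assms by (cases N) auto
  then show ?thesis unfolding H_par_def using num_queries_upper[OF assms] by linarith
qed

lemma sum_split_1: "N \<ge> 1 \<Longrightarrow> (\<Sum>k = 1..N. f k) = f 1 + (\<Sum>k = 2..N. f k)" for f :: "nat \<Rightarrow> nat"
  by (simp add: sum.atLeast_Suc_atMost numeral_2_eq_2)

text \<open>The initial counters \<open>t\<^sub>i = 1\<close> account for the terms with \<open>k = 1\<close>.\<close>

lemma final_counter_neq:
  assumes "S \<ge> 2" "N \<ge> 2" "i \<noteq> d"
  shows "1 + (\<Sum>k = 2..N. \<Sum>s = 1..S. fresh_count N S s i d k) = S ^ (N - 1)"
proof -
  have "(\<Sum>k = 1..N. \<Sum>s = 1..S. fresh_count N S s i d k) = S ^ (N - 1)"
    using sum_choose_phi_nat[of S N] assms by (simp add: fresh_count_neq)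
  then show ?thesis using assms by (subst (asm) sum_split_1) (auto simp: fresh_count_1)
qed

lemma final_counter_eq:
  assumes "S \<ge> 2" "N \<ge> 2"
  shows "1 + (\<Sum>k = 2..N. \<Sum>s = 1..S. fresh_count N S s d d k) = H_par N S"
proof -
  have "(\<Sum>k = 1..N. \<Sum>s = 1..S. fresh_count N S s d d k) = H_par N S"
    using num_queries_eq[of S N d] assms by (simp add: H_par_def)
  then show ?thesis using assms by (subst (asm) sum_split_1) (auto simp: fresh_count_1)
qed

lemma num_queries_split:
  assumes "S \<ge> 2" "N \<ge> 2"
  shows "N + (\<Sum>k = 2..N. \<Sum>s = 1..S. (N choose k) * psi N S s k) = num_queries N S"
  unfolding num_queries_def using assms
  by (subst sum_split_1) (auto simp: psi_1 simp flip: sum_distrib_left)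

text \<open>Used with at most two prescribed files, for the column sums of the fractional
  assignment.\<close>

lemma card_subsets_between:
  assumes "finite A" "I \<subseteq> A" "O' \<subseteq> A" "I \<inter> O' = {}" "card I \<le> k"
  shows "card {U. U \<subseteq> A \<and> card U = k \<and> I \<subseteq> U \<and> U \<inter> O' = {}}
    = (card A - card I - card O') choose (k - card I)"
proof -
  let ?B = "A - I - O'"
  have fin: "finite I" "finite O'" using assms(1-3) by (blast intro: finite_subset)+
  have "bij_betw (\<lambda>V. I \<union> V) {V. V \<subseteq> ?B \<and> card V = k - card I}
      {U. U \<subseteq> A \<and> card U = k \<and> I \<subseteq> U \<and> U \<inter> O' = {}}"
  proof (rule bij_betw_byWitness[of _ "\<lambda>U. U - I"])
    show "(\<lambda>V. I \<union> V) ` {V. V \<subseteq> ?B \<and> card V = k - card I}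
        \<subseteq> {U. U \<subseteq> A \<and> card U = k \<and> I \<subseteq> U \<and> U \<inter> O' = {}}"
    proof safe
      fix V assume V: "V \<subseteq> ?B" "card V = k - card I"
      have "card (I \<union> V) = card I + card V"
        using V fin assms(1) by (intro card_Un_disjoint) (auto intro: finite_subset)
      then show "card (I \<union> V) = k" using V assms(5) by simp
    qed (use assms in auto)
    show "(\<lambda>U. U - I) ` {U. U \<subseteq> A \<and> card U = k \<and> I \<subseteq> U \<and> U \<inter> O' = {}}
        \<subseteq> {V. V \<subseteq> ?B \<and> card V = k - card I}"
      using fin by (auto simp: card_Diff_subset)
  qed auto
  then have "card {U. U \<subseteq> A \<and> card U = k \<and> I \<subseteq> U \<and> U \<inter> O' = {}}
      = card {V. V \<subseteq> ?B \<and> card V = k - card I}"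
    by (simp add: bij_betw_same_card)
  also have "\<dots> = card ?B choose (k - card I)" using assms(1) by (intro n_subsets) simp
  also have "card ?B = card A - card I - card O'"
    using assms fin by (subst card_Diff_subset; auto simp: card_Diff_subset)
  finally show ?thesis .
qed

section \<open>Existence of complete runs\<close>

lemma for_loop_exists:
  assumes "\<And>x a. x \<in> set xs \<Longrightarrow> \<exists>b. R x a b"
  shows "\<exists>b. for_loop R xs a b"
  using assms
proof (induction xs arbitrary: a)
  case (Cons x xs)
  then obtain a' where "R x a a'" by force
  moreover obtain b where "for_loop R xs a' b" using Cons by force
  ultimately show ?case by auto
qed simp

text \<open>Indexing the invariant by the set of loop values already processed allows counters to be
  stated as sums over that set.\<close>

lemma for_loop_invariant:
  assumes "for_loop R xs a b" "distinct xs" "P {} a"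
    and step: "\<And>A x a b. A \<subseteq> set xs \<Longrightarrow> x \<in> set xs - A \<Longrightarrow> P A a \<Longrightarrow> R x a b \<Longrightarrow> P (insert x A) b"
  shows "P (set xs) b"
proof -
  have "P (A \<union> set ys) b"
    if "for_loop R ys a b" "distinct ys" "A \<inter> set ys = {}" "A \<union> set ys \<subseteq> set xs" "P A a"
    for ys A a
    using that
  proof (induction ys arbitrary: A a)
    case (Cons y ys)
    then obtain a' where a': "R y a a'" "for_loop R ys a' b" by auto
    have "P (insert y A) a'" using Cons.prems a'(1) by (intro step[of A y a]) auto
    then have "P (insert y A \<union> set ys) b" using Cons.prems a'(2) by (intro Cons.IH) auto
    then show ?case by simp
  qed simp
  from this[of xs a "{}"] show ?thesis using assms by simp
qed

lemma qstep_a_exists: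
  assumes "U \<in># \<C>" "i \<in> U"
  shows "\<exists>Q' t'. qstep tau T s i (Q, t, \<C>, \<T>) (Q', t', \<C> - {#U#}, add_mset U \<T>)"
  using qstep.step_a[OF assms refl] by blast

text \<open>Step (a) may pick any set containing \<open>i\<close>, in particular one from the share
  \<open>D\<close> reserved for \<open>i\<close>; the rest \<open>R\<close>, reserved for later
  files, stays intact.\<close>

lemma qsteps_exist:
  assumes "\<forall>U\<in>#D. i \<in> U"
  shows "\<exists>Q' t' \<T>'. (qstep tau T s i ^^ size D) (Q, t, D + R, \<T>) (Q', t', R, \<T>')"
  using assms
proof (induction D arbitrary: Q t \<T>)
  case (add U D)
  obtain Q1 t1 where 1: "qstep tau T s i (Q, t, add_mset U D + R, \<T>) (Q1, t1, D + R, add_mset U \<T>)"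
    using qstep_a_exists[of U "add_mset U D + R" i tau T s Q t \<T>] add.prems by auto
  obtain Q' t' \<T>' where "(qstep tau T s i ^^ size D) (Q1, t1, D + R, add_mset U \<T>) (Q', t', R, \<T>')"
    using add by force
  with 1 have "(qstep tau T s i ^^ Suc (size D)) (Q, t, add_mset U D + R, \<T>) (Q', t', R, \<T>')"
    by (rule relpowp_Suc_I2)
  then show ?case by auto
qed auto

lemma qstep_loop_exists:
  assumes "\<And>i. i \<in> set xs \<Longrightarrow> size (D i) = n i \<and> (\<forall>U\<in>#D i. i \<in> U)"
  shows "\<exists>Q' t' \<T>'. for_loop (\<lambda>i. qstep tau T s i ^^ n i) xs
    (Q, t, sum_list (map D xs), \<T>) (Q', t', {#}, \<T>')"
  using assms
proof (induction xs arbitrary: Q t \<T>)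
  case (Cons x xs)
  obtain Q1 t1 T1 where 1: "(qstep tau T s x ^^ n x) (Q, t, sum_list (map D (x # xs)), \<T>)
      (Q1, t1, sum_list (map D xs), T1)"
    using qsteps_exist[of "D x" x tau T s Q t "sum_list (map D xs)" \<T>] Cons.prems[of x] by auto
  obtain Q' t' \<T>' where "for_loop (\<lambda>i. qstep tau T s i ^^ n i) xs
      (Q1, t1, sum_list (map D xs), T1) (Q', t', {#}, \<T>')"
    using Cons by force
  with 1 show ?case by auto
qed auto

text \<open>The symmetric fractional choice of the fresh file of every query: a set \<open>U\<close> containing the
  demanded file \<open>d\<close> uses it with weight \<open>F\<^sub>d / (binom(N - 1, k - 1) \<psi>)\<close>, and
  all other weight is spread evenly over \<open>U - {d}\<close>.\<close>

lemma fresh_assignment: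
  assumes S: "S \<ge> 2" and k: "2 \<le> k" "k \<le> N" and d: "d \<in> {1..N}"
  shows "\<exists>D. (\<Sum>i = 1..N. D i)
      = repeat_mset (psi N S s k) (mset_set {U. U \<subseteq> {1..N} \<and> card U = k})
    \<and> (\<forall>i\<in>{1..N}. size (D i) = fresh_count N S s i d k \<and> (\<forall>U\<in>#D i. i \<in> U))"
proof -
  define X where "X = {U. U \<subseteq> {1..N} \<and> card U = k}"
  let ?\<psi> = "psi N S s k" and ?c = "N - 1 choose (k - 1)"
  let ?F = "\<lambda>i. fresh_count N S s i d k"
  define \<alpha> where "\<alpha> = real (?F d) / (real ?c * real ?\<psi>)"
  \<comment> \<open>The second component numbers the copies of \<open>U\<close> in the multiset; all
    copies get the same weights.\<close>
  define w where "w = (\<lambda>(U, n::nat) i. if i \<notin> U then 0 else if d \<notin> U then 1 / real k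
    else if i = d then \<alpha> else (1 - \<alpha>) / (real k - 1))"
  define A where "A i = {U \<in> X. i \<in> U \<and> d \<notin> U}" for i
  define B where "B i = {U \<in> X. i \<in> U \<and> d \<in> U}" for i
  have c: "?c > 0" using k by simp
  have finX: "finite X" by (simp add: X_def)
  have cardX: "card X = N choose k" unfolding X_def by (subst n_subsets) auto
  have \<alpha>: "0 \<le> \<alpha>" "\<alpha> \<le> 1"
  proof -
    have "real (?F d) \<le> real ?c * real ?\<psi>"
      using fresh_count_demand_le[of S k N s d] S k by (metis of_nat_le_iff of_nat_mult one_le_numeral order_trans)
    then show "0 \<le> \<alpha>" "\<alpha> \<le> 1" by (auto simp: \<alpha>_def divide_le_eq)
  qed
  \<comment> \<open>This includes \<open>?\<psi> = 0\<close>: there \<open>\<alpha>\<close> is 0 by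
    division by zero, and the count of \<open>d\<close> is 0 by the bound just used.\<close>
  have \<alpha>F: "real ?c * real ?\<psi> * \<alpha> = real (?F d)"
    using fresh_count_demand_le[of S k N s d] S k c by (auto simp: \<alpha>_def)
  have row: "(\<Sum>i = 1..N. w x i) = 1" if x: "x \<in> X \<times> {..<?\<psi>}" for x
  proof -
    obtain U n where x': "x = (U, n)" by fastforce
    have U: "U \<subseteq> {1..N}" "card U = k" "finite U"
      using x x' by (auto simp: X_def intro: finite_subset)
    have "(\<Sum>i = 1..N. w x i) = (\<Sum>i\<in>U. w x i)"
      using U by (intro sum.mono_neutral_right) (auto simp: w_def x')
    also have "\<dots> = 1"
    proof (cases "d \<in> U")
      case True
      have "(\<Sum>i\<in>U. w x i) = \<alpha> + (\<Sum>i\<in>U - {d}. (1 - \<alpha>) / (real k - 1))"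
        using U True by (simp add: sum.remove[of U d] w_def x')
      also have "\<dots> = 1" using U True k by (simp add: card_Diff_singleton of_nat_diff)
      finally show ?thesis .
    next
      case False
      have "(\<Sum>i\<in>U. w x i) = (\<Sum>i\<in>U. 1 / real k)"
        using False by (intro sum.cong) (auto simp: w_def x')
      then show ?thesis using U k by simp
    qed
    finally show ?thesis .
  qed
  have AB: "card (A i) = N - 2 choose (k - 1)" "card (B i) = N - 2 choose (k - 2)"
    if "i \<in> {1..N}" "i \<noteq> d" for i
  proof -
    have "A i = {U. U \<subseteq> {1..N} \<and> card U = k \<and> {i} \<subseteq> U \<and> U \<inter> {d} = {}}"
      by (auto simp: A_def X_def)
    then show "card (A i) = N - 2 choose (k - 1)"
      using card_subsets_between[of "{1..N}" "{i}" "{d}" k] that d k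
      by (simp add: numeral_2_eq_2)
    have "B i = {U. U \<subseteq> {1..N} \<and> card U = k \<and> {i, d} \<subseteq> U \<and> U \<inter> {} = {}}"
      by (auto simp: B_def X_def)
    then show "card (B i) = N - 2 choose (k - 2)"
      using card_subsets_between[of "{1..N}" "{i, d}" "{}" k] that d k
      by (simp add: numeral_2_eq_2)
  qed
  have sumX: "(\<Sum>x\<in>X \<times> {..<?\<psi>}. w x i) = real ?\<psi> * (\<Sum>U\<in>X. w (U, 0) i)" for i
  proof -
    have "(\<Sum>x\<in>X \<times> {..<?\<psi>}. w x i) = (\<Sum>U\<in>X. \<Sum>n<?\<psi>. w (U, n) i)"
      by (simp add: sum.cartesian_product)
    also have "\<dots> = (\<Sum>U\<in>X. \<Sum>n<?\<psi>. w (U, 0) i)" by (simp add: w_def)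
    finally show ?thesis by (simp add: sum_distrib_left)
  qed
  have "(\<Sum>U\<in>X. w (U, 0) d) = (\<Sum>U\<in>B d. w (U, 0) d)"
    using finX by (intro sum.mono_neutral_right) (auto simp: w_def B_def)
  also have "\<dots> = real (card (B d)) * \<alpha>" by (simp add: w_def B_def)
  also have "B d = {U. U \<subseteq> {1..N} \<and> card U = k \<and> {d} \<subseteq> U \<and> U \<inter> {} = {}}"
    by (auto simp: B_def X_def)
  also have "card \<dots> = ?c"
    using card_subsets_between[of "{1..N}" "{d}" "{}" k] d k by simp
  finally have col_d: "(\<Sum>x\<in>X \<times> {..<?\<psi>}. w x d) = real (?F d)"
    using \<alpha>F by (simp add: sumX mult_ac)
  define \<beta> where "\<beta> = real ?\<psi> * (real (N - 2 choose (k - 1)) / real k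
    + real (N - 2 choose (k - 2)) * ((1 - \<alpha>) / (real k - 1)))"
  have col_\<beta>: "(\<Sum>x\<in>X \<times> {..<?\<psi>}. w x i) = \<beta>" if i: "i \<in> {1..N} - {d}" for i
  proof -
    have "(\<Sum>U\<in>X. w (U, 0) i) = (\<Sum>U\<in>A i \<union> B i. w (U, 0) i)"
      using finX by (intro sum.mono_neutral_right) (auto simp: w_def A_def B_def)
    also have "\<dots> = (\<Sum>U\<in>A i. w (U, 0) i) + (\<Sum>U\<in>B i. w (U, 0) i)"
      using finX by (intro sum.union_disjoint) (auto simp: A_def B_def)
    also have "(\<Sum>U\<in>A i. w (U, 0) i) = (\<Sum>U\<in>A i. 1 / real k)"
      by (intro sum.cong) (auto simp: w_def A_def)
    also have "(\<Sum>U\<in>B i. w (U, 0) i) = (\<Sum>U\<in>B i. (1 - \<alpha>) / (real k - 1))"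
      using i by (intro sum.cong) (auto simp: w_def B_def)
    finally show ?thesis using i AB[of i] by (simp add: sumX \<beta>_def)
  qed
  \<comment> \<open>By symmetry all columns except \<open>d\<close> have the same sum
    \<open>\<beta>\<close>. Its value is read off from the total weight, one per copy of a set,
    instead of simplifying its binomial expression.\<close>
  have "real (N - 1) * \<beta> + real (?F d) = (\<Sum>i = 1..N. \<Sum>x\<in>X \<times> {..<?\<psi>}. w x i)"
  proof -
    have "(\<Sum>i\<in>{1..N} - {d}. \<Sum>x\<in>X \<times> {..<?\<psi>}. w x i) = (\<Sum>i\<in>{1..N} - {d}. \<beta>)"
      by (intro sum.cong refl col_\<beta>)
    also have "\<dots> = real (N - 1) * \<beta>" using d by (simp add: card_Diff_singleton)
    finally show ?thesis using d col_d by (subst sum.remove[of "{1..N}" d]) auto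
  qed
  also have "\<dots> = (\<Sum>x\<in>X \<times> {..<?\<psi>}. \<Sum>i = 1..N. w x i)" by (rule sum.swap)
  also have "\<dots> = real ((N choose k) * ?\<psi>)"
    using row by (simp add: cardX card_cartesian_product)
  also have "\<dots> = real (?F d + (N - 1) * (?c * phi_nat S s k))"
    using fresh_count_eq[of S k N s d] S k by simp
  finally have \<beta>: "\<beta> = real (?c * phi_nat S s k)" using k by simp
  have col: "(\<Sum>x\<in>X \<times> {..<?\<psi>}. w x i) = real (?F i)" if "i \<in> {1..N}" for i
    using that col_d col_\<beta>[of i] S k by (cases "i = d") (auto simp: \<beta> fresh_count_neq)
  have "\<exists>h. bij_betw h (SIGMA i:{1..N}. {..<?F i}) (X \<times> {..<?\<psi>})
      \<and> (\<forall>i\<in>{1..N}. \<forall>n<?F i. i \<in> fst (h (i, n)))"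
  proof (rule integral_assignment[of "X \<times> {..<?\<psi>}" "{1..N}" w fst ?F])
    show "0 \<le> w x i" for x i using \<alpha> k by (auto simp: w_def split: prod.splits)
    show "i \<in> fst x" if "w x i \<noteq> 0" for x i
      using that by (auto simp: w_def split: prod.splits if_splits)
  qed (use finX row col in auto)
  then obtain h where h: "bij_betw h (SIGMA i:{1..N}. {..<?F i}) (X \<times> {..<?\<psi>})"
    and hi: "\<And>i n. i \<in> {1..N} \<Longrightarrow> n < ?F i \<Longrightarrow> i \<in> fst (h (i, n))" by blast
  define D where "D i = image_mset (\<lambda>n. fst (h (i, n))) (mset_set {..<?F i})" for i
  have "(\<Sum>i = 1..N. D i) = repeat_mset ?\<psi> (mset_set X)"
  \<comment> \<open>The multiplicity of \<open>U\<close> on the left is the number of slots that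
    \<open>h\<close> sends to a copy of \<open>U\<close>; bijectivity makes this the number of
    copies.\<close>
  proof (rule multiset_eqI)
    fix U
    let ?I = "SIGMA i:{1..N}. {..<?F i}"
    have "count (D i) U = card {n \<in> {..<?F i}. fst (h (i, n)) = U}" for i
      by (simp add: D_def count_image_mset Int_def vimage_def conj_commute)
    then have "count (\<Sum>i = 1..N. D i) U = (\<Sum>i = 1..N. card {n \<in> {..<?F i}. fst (h (i, n)) = U})"
      by (simp add: count_sum)
    also have "\<dots> = card (SIGMA i:{1..N}. {n \<in> {..<?F i}. fst (h (i, n)) = U})"
      by (subst card_SigmaI) auto
    also have "(SIGMA i:{1..N}. {n \<in> {..<?F i}. fst (h (i, n)) = U}) = {z \<in> ?I. fst (h z) = U}"
      by auto
    also have "card \<dots> = card (h ` {z \<in> ?I. fst (h z) = U})"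
      using h by (intro card_image[symmetric]) (auto simp: bij_betw_def intro: inj_on_subset)
    also have "h ` {z \<in> ?I. fst (h z) = U} = {x \<in> h ` ?I. fst x = U}" by blast
    also have "h ` ?I = X \<times> {..<?\<psi>}" using h by (simp add: bij_betw_def)
    also have "{x \<in> X \<times> {..<?\<psi>}. fst x = U} = (if U \<in> X then {U} \<times> {..<?\<psi>} else {})" by auto
    also have "card \<dots> = count (repeat_mset ?\<psi> (mset_set X)) U"
      using finX by (simp add: card_cartesian_product)
    finally show "count (\<Sum>i = 1..N. D i) U = \<dots>" .
  qed
  moreover have "size (D i) = ?F i \<and> (\<forall>U\<in>#D i. i \<in> U)" if "i \<in> {1..N}" for i
    using hi that by (auto simp: D_def)
  ultimately show ?thesis unfolding X_def by blast
qed

text \<open>Each block builds its multiset anew, so it can be completed from any state, whatever was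
  chosen before; blocks and rounds can thus be chained freely.\<close>

lemma qblock_exists:
  assumes "S \<ge> 2" "2 \<le> k" "k \<le> N" "d \<in> {1..N}"
  shows "\<exists>b. qblock N S tau d k T s a b"
proof -
  obtain Q t where a: "a = (Q, t)" by fastforce
  obtain D where D: "(\<Sum>i = 1..N. D i)
      = repeat_mset (psi N S s k) (mset_set {U. U \<subseteq> {1..N} \<and> card U = k})"
    "\<And>i. i \<in> {1..N} \<Longrightarrow> size (D i) = fresh_count N S s i d k \<and> (\<forall>U\<in>#D i. i \<in> U)"
    using fresh_assignment[OF assms, of s] by blast
  have "sum_list (map D [1..<N + 1]) = (\<Sum>i = 1..N. D i)"
    by (simp add: sum_list_distinct_conv_sum_set atLeastLessThanSuc_atLeastAtMost del: upt_Suc)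
  moreover obtain Q' t' \<T>' where "for_loop (\<lambda>i. qstep tau T s i ^^ fresh_count N S s i d k)
      [1..<N + 1] (Q, t, sum_list (map D [1..<N + 1]), {#}) (Q', t', {#}, \<T>')"
    using qstep_loop_exists[of "[1..<N + 1]" D "\<lambda>i. fresh_count N S s i d k" tau T s Q t "{#}"] D(2)
    by (auto simp: less_Suc_eq_le simp del: upt_Suc)
  ultimately show ?thesis unfolding a qblock_def D(1) by force
qed

lemma QSet1_nonempty:
  assumes "S \<ge> 2" "d \<in> {1..N}"
  shows "QSet1 N S tau j a d \<noteq> {}"
proof -
  have "\<exists>b. qround N S tau d k (Q, t) b" if "k \<in> set [2..<N + 1]" for k Q t
    unfolding qround_def prod.case using that assms by (intro for_loop_exists qblock_exists) auto
  then have "\<exists>b. qround N S tau d k x b" if "k \<in> set [2..<N + 1]" for k x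
    using that by (metis surj_pair)
  then have "\<exists>b. for_loop (qround N S tau d) [2..<N + 1] (qinit N) b"
    by (rule for_loop_exists)
  then show ?thesis by (auto simp: QSet1_def simp del: upt_Suc)
qed

section \<open>The invariant of a round\<close>

text \<open>Only the queries without positions above \<open>T\<close> are used: step (b) changes the others.\<close>

definition decodable :: "nat \<Rightarrow> nat \<Rightarrow> (nat \<Rightarrow> pos_query set) \<Rightarrow> (nat \<Rightarrow> nat) \<Rightarrow> bool" where
  "decodable N S Q T \<longleftrightarrow> (\<forall>f f' :: nat \<times> nat \<Rightarrow> bit.
     (\<forall>s\<in>{1..S}. \<forall>x\<in>Q s. (\<forall>(v, y)\<in>x. y \<le> T v) \<longrightarrow> sum f x = sum f' x) \<longrightarrow>
     (\<forall>i\<in>{1..N}. \<forall>y\<in>{1..T i}. f (i, y) = f' (i, y)))"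

text \<open>Within a round every query added or removed contains a position above \<open>T\<close>,
  so the queries that count for decoding persist.\<close>

lemma decodable_mono:
  assumes "decodable N S Q T"
    and "\<And>s x. x \<in> Q s \<Longrightarrow> (\<forall>(v, y)\<in>x. y \<le> T v) \<Longrightarrow> x \<in> Q' s"
  shows "decodable N S Q' T"
  unfolding decodable_def
proof (intro allI impI)
  fix f f' :: "nat \<times> nat \<Rightarrow> bit"
  assume "\<forall>s\<in>{1..S}. \<forall>x\<in>Q' s. (\<forall>(v, y)\<in>x. y \<le> T v) \<longrightarrow> sum f x = sum f' x"
  then have "\<forall>s\<in>{1..S}. \<forall>x\<in>Q s. (\<forall>(v, y)\<in>x. y \<le> T v) \<longrightarrow> sum f x = sum f' x"
    using assms(2) by blast
  with assms(1) show "\<forall>i\<in>{1..N}. \<forall>y\<in>{1..T i}. f (i, y) = f' (i, y)"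
    unfolding decodable_def by blast
qed

text \<open>A position \<open>y > T\<^sub>v\<close> of file \<open>v\<close> is fresh in the current round.  The queries of the round
  correspond to the fresh positions: each contains exactly one, and each is contained in a
  query that, for a given database, is unique.\<close>

definition round_inv ::
  "nat \<Rightarrow> nat \<Rightarrow> (nat \<Rightarrow> nat) \<Rightarrow> (nat \<Rightarrow> pos_query set) \<Rightarrow> (nat \<Rightarrow> nat) \<Rightarrow> bool" where
  "round_inv N S T Q t \<longleftrightarrow>
     (\<forall>v\<in>{1..N}. 1 \<le> T v \<and> T v \<le> t v) \<and>
     (\<forall>s. finite (Q s)) \<and>
     (\<forall>s. \<forall>x\<in>Q s. x \<noteq> {} \<and> (\<forall>v y. (v, y) \<in> x \<longrightarrow> v \<in> {1..N} \<and> 1 \<le> y \<and> y \<le> t v)) \<and>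
     (\<forall>s. \<forall>x\<in>Q s. \<forall>v y v' y'. (v, y) \<in> x \<longrightarrow> T v < y \<longrightarrow> (v', y') \<in> x \<longrightarrow> (v', y') \<noteq> (v, y) \<longrightarrow>
        y' \<le> T v') \<and>
     (\<forall>s. \<forall>x\<in>Q s. \<forall>x'\<in>Q s. \<forall>v y. (v, y) \<in> x \<longrightarrow> (v, y) \<in> x' \<longrightarrow> T v < y \<longrightarrow> x = x') \<and>
     (\<forall>v\<in>{1..N}. \<forall>y. T v < y \<longrightarrow> y \<le> t v \<longrightarrow> (\<exists>s\<in>{1..S}. \<exists>x\<in>Q s. (v, y) \<in> x)) \<and>
     decodable N S Q T"

lemma round_invI:
  assumes "\<And>v. v \<in> {1..N} \<Longrightarrow> 1 \<le> T v \<and> T v \<le> t v"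
    and "\<And>s. finite (Q s)"
    and "\<And>s x. x \<in> Q s \<Longrightarrow> x \<noteq> {}"
    and "\<And>s x v y. x \<in> Q s \<Longrightarrow> (v, y) \<in> x \<Longrightarrow> v \<in> {1..N} \<and> 1 \<le> y \<and> y \<le> t v"
    and "\<And>s x v y v' y'. x \<in> Q s \<Longrightarrow> (v, y) \<in> x \<Longrightarrow> T v < y \<Longrightarrow> (v', y') \<in> x \<Longrightarrow>
      (v', y') \<noteq> (v, y) \<Longrightarrow> y' \<le> T v'"
    and "\<And>s x x' v y. x \<in> Q s \<Longrightarrow> x' \<in> Q s \<Longrightarrow> (v, y) \<in> x \<Longrightarrow> (v, y) \<in> x' \<Longrightarrow> T v < y \<Longrightarrow> x = x'"
    and "\<And>v y. v \<in> {1..N} \<Longrightarrow> T v < y \<Longrightarrow> y \<le> t v \<Longrightarrow> \<exists>s\<in>{1..S}. \<exists>x\<in>Q s. (v, y) \<in> x"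
    and "decodable N S Q T"
  shows "round_inv N S T Q t"
  unfolding round_inv_def
  apply (intro conjI allI ballI impI)
  subgoal using assms(1) by blast
  subgoal using assms(1) by blast
  subgoal by (rule assms(2))
  subgoal by (rule assms(3))
  subgoal using assms(4) by blast
  subgoal using assms(4) by blast
  subgoal using assms(4) by blast
  subgoal by (rule assms(5))
  subgoal by (rule assms(6))
  subgoal by (rule assms(7))
  subgoal by (rule assms(8))
  done

text \<open>The conclusions are cited by number: (7) bounds positions by the counters, (8) allows
  one fresh position per query, (9) is uniqueness of its query within a database, (10) existence of
  such a query, (11) decodability up to \<open>T\<close>.\<close>

lemma round_invD:
  assumes "round_inv N S T Q t"
  shows "\<And>v. v \<in> {1..N} \<Longrightarrow> 1 \<le> T v" "\<And>v. v \<in> {1..N} \<Longrightarrow> T v \<le> t v"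
    and "\<And>s. finite (Q s)"
    and "\<And>s x. x \<in> Q s \<Longrightarrow> x \<noteq> {}"
    and "\<And>s x v y. x \<in> Q s \<Longrightarrow> (v, y) \<in> x \<Longrightarrow> v \<in> {1..N}"
    and "\<And>s x v y. x \<in> Q s \<Longrightarrow> (v, y) \<in> x \<Longrightarrow> 1 \<le> y"
    and "\<And>s x v y. x \<in> Q s \<Longrightarrow> (v, y) \<in> x \<Longrightarrow> y \<le> t v"
    and "\<And>s x v y v' y'. x \<in> Q s \<Longrightarrow> (v, y) \<in> x \<Longrightarrow> T v < y \<Longrightarrow> (v', y') \<in> x \<Longrightarrow>
      (v', y') \<noteq> (v, y) \<Longrightarrow> y' \<le> T v'"
    and "\<And>s x x' v y. x \<in> Q s \<Longrightarrow> x' \<in> Q s \<Longrightarrow> (v, y) \<in> x \<Longrightarrow> (v, y) \<in> x' \<Longrightarrow> T v < y \<Longrightarrow> x = x'"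
    and "\<And>v y. v \<in> {1..N} \<Longrightarrow> T v < y \<Longrightarrow> y \<le> t v \<Longrightarrow> \<exists>s\<in>{1..S}. \<exists>x\<in>Q s. (v, y) \<in> x"
    and "decodable N S Q T"
proof -
  have inv: "\<forall>v\<in>{1..N}. 1 \<le> T v \<and> T v \<le> t v" "\<forall>s. finite (Q s)"
    "\<forall>s. \<forall>x\<in>Q s. x \<noteq> {} \<and> (\<forall>v y. (v, y) \<in> x \<longrightarrow> v \<in> {1..N} \<and> 1 \<le> y \<and> y \<le> t v)"
    "\<forall>s. \<forall>x\<in>Q s. \<forall>v y v' y'. (v, y) \<in> x \<longrightarrow> T v < y \<longrightarrow> (v', y') \<in> x \<longrightarrow> (v', y') \<noteq> (v, y) \<longrightarrow>
        y' \<le> T v'"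
    "\<forall>s. \<forall>x\<in>Q s. \<forall>x'\<in>Q s. \<forall>v y. (v, y) \<in> x \<longrightarrow> (v, y) \<in> x' \<longrightarrow> T v < y \<longrightarrow> x = x'"
    "\<forall>v\<in>{1..N}. \<forall>y. T v < y \<longrightarrow> y \<le> t v \<longrightarrow> (\<exists>s\<in>{1..S}. \<exists>x\<in>Q s. (v, y) \<in> x)"
    and dec: "decodable N S Q T"
    using assms unfolding round_inv_def by simp_all
  show "1 \<le> T v" "T v \<le> t v" if "v \<in> {1..N}" for v
    using inv(1) that by blast+
  show "finite (Q s)" for s using inv(2) by blast
  show "x \<noteq> {}" if "x \<in> Q s" for s x using inv(3) that by blast
  show "v \<in> {1..N}" "1 \<le> y" "y \<le> t v" if "x \<in> Q s" "(v, y) \<in> x" for s x v y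
    using inv(3) that by blast+
  show "y' \<le> T v'" if "x \<in> Q s" "(v, y) \<in> x" "T v < y" "(v', y') \<in> x" "(v', y') \<noteq> (v, y)"
    for s x v y v' y' using inv(4) that by blast
  show "x = x'" if "x \<in> Q s" "x' \<in> Q s" "(v, y) \<in> x" "(v, y) \<in> x'" "T v < y" for s x x' v y
    using inv(5) that by blast
  show "\<exists>s\<in>{1..S}. \<exists>x\<in>Q s. (v, y) \<in> x" if "v \<in> {1..N}" "T v < y" "y \<le> t v" for v y
    using inv(6) that by blast
  show "decodable N S Q T" by (rule dec)
qed

lemma round_inv_add_query:
  assumes inv: "round_inv N S T Q t" and s: "s \<in> {1..S}" and i: "i \<in> {1..N}"
    and R: "\<And>v y. (v, y) \<in> R \<Longrightarrow> v \<in> {1..N} \<and> 1 \<le> y \<and> y \<le> T v"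
    and x_def: "x = insert (i, t i + 1) R"
  shows "round_inv N S T (Q(s := insert x (Q s))) (t(i := t i + 1))"
    and "card (insert x (Q s)) = card (Q s) + 1"
proof -
  note I = round_invD[OF inv]
  \<comment> \<open>No old query reaches position \<open>t i + 1\<close> of file \<open>i\<close>,
    so the insertion really enlarges the set.\<close>
  have new: "x \<notin> Q s" using I(7)[of x s i "t i + 1"] by (auto simp: x_def)
  then show "card (insert x (Q s)) = card (Q s) + 1" using I(3) by simp
  have Ti: "T i < t i + 1" using I(2)[OF i] by simp
  have x_fresh: "v = i \<and> y = t i + 1" if "(v, y) \<in> x" "T v < y" for v y
    using that R by (force simp: x_def)
  have x_bound: "v \<in> {1..N} \<and> 1 \<le> y \<and> y \<le> (t(i := t i + 1)) v" if "(v, y) \<in> x" for v y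
    using that R I(2)[of v] i by (force simp: x_def)
  have old: "(i, t i + 1) \<notin> z" if "z \<in> Q s" for z
    using I(7)[OF that, of i "t i + 1"] by auto
  show "round_inv N S T (Q(s := insert x (Q s))) (t(i := t i + 1))" (is "round_inv N S T ?Q ?t")
  proof (rule round_invI)
    show "1 \<le> T v \<and> T v \<le> ?t v" if "v \<in> {1..N}" for v
      using I(1,2)[OF that] by auto
    show "finite (?Q s')" for s' using I(3) by simp
    show "z \<noteq> {}" if "z \<in> ?Q s'" for s' z
      using that I(4)[of z s'] by (auto simp: x_def split: if_splits)
    show "v \<in> {1..N} \<and> 1 \<le> y \<and> y \<le> ?t v" if "z \<in> ?Q s'" "(v, y) \<in> z" for s' z v y
    proof (cases "z = x")
      case True
      then show ?thesis using x_bound that by blast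
    next
      case False
      then have z: "z \<in> Q s'" using that by (auto split: if_splits)
      have "y \<le> ?t v" using I(7)[OF z that(2)] by auto
      then show ?thesis using I(5,6)[OF z that(2)] by blast
    qed
    show "y' \<le> T v'" if "z \<in> ?Q s'" "(v, y) \<in> z" "T v < y" "(v', y') \<in> z" "(v', y') \<noteq> (v, y)"
      for s' z v y v' y'
    proof (cases "z = x")
      case True
      then show ?thesis using that x_fresh by (metis not_less)
    next
      case False
      then have z: "z \<in> Q s'" using that by (auto split: if_splits)
      then show ?thesis using I(8) that(2-5) by blast
    qed
    show "z = z'" if z: "z \<in> ?Q s'" "z' \<in> ?Q s'" "(v, y) \<in> z" "(v, y) \<in> z'" "T v < y"
      for s' z z' v y
    proof (cases "s' = s \<and> (z = x \<or> z' = x)")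
      case True
      then have "v = i \<and> y = t i + 1" using x_fresh z by blast
      then have "z \<notin> Q s" "z' \<notin> Q s" using old z(3,4) by auto
      then show ?thesis using True z by auto
    next
      case False
      then have "z \<in> Q s'" "z' \<in> Q s'" using z by (auto split: if_splits)
      then show ?thesis using I(9) z by blast
    qed
    show "\<exists>s\<in>{1..S}. \<exists>z\<in>?Q s. (v, y) \<in> z" if vy: "v \<in> {1..N}" "T v < y" "y \<le> ?t v" for v y
    proof (cases "v = i \<and> y = t i + 1")
      case True
      then show ?thesis using s by (intro bexI[of _ s]) (auto simp: x_def)
    next
      case False
      then have "y \<le> t v" using vy by (auto split: if_splits)
      then obtain s' z where "s' \<in> {1..S}" "z \<in> Q s'" "(v, y) \<in> z" using I(10)[OF vy(1,2)] by blast
      then show ?thesis by (intro bexI[of _ s'] bexI[of _ z]) auto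
    qed
    show "decodable N S ?Q T" by (rule decodable_mono[OF I(11)]) auto
  qed
qed

text \<open>The fresh position moves from \<open>q\<close> to \<open>x\<close>. As \<open>q\<close>
  was its only query at this database, it is again in exactly one there, and \<open>x\<close> cannot
  coincide with a remaining query.\<close>

lemma round_inv_replace_query:
  assumes inv: "round_inv N S T Q t" and s: "s \<in> {1..S}"
    and R: "\<And>v y. (v, y) \<in> R \<Longrightarrow> v \<in> {1..N} \<and> 1 \<le> y \<and> y \<le> T v"
    and q: "q \<in> Q s" "(v1, x1) \<in> q" "T v1 < x1"
    and x_def: "x = insert (v1, x1) R"
  shows "round_inv N S T (Q(s := insert x (Q s - {q}))) t"
    and "card (insert x (Q s - {q})) = card (Q s)"
proof -
  note I = round_invD[OF inv]
  have new: "x \<notin> Q s - {q}" using I(9)[OF q(1) _ q(2) _ q(3)] by (auto simp: x_def)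
  then have "card (insert x (Q s - {q})) = Suc (card (Q s - {q}))" using I(3) by simp
  then show "card (insert x (Q s - {q})) = card (Q s)"
    using card_Suc_Diff1[OF I(3) q(1)] by simp
  have x_fresh: "v = v1 \<and> y = x1" if "(v, y) \<in> x" "T v < y" for v y
    using that R by (force simp: x_def)
  have x_bound: "v \<in> {1..N} \<and> 1 \<le> y \<and> y \<le> t v" if "(v, y) \<in> x" for v y
    using that R[of v y] I(2)[of v] I(5,6,7)[OF q(1,2)] by (force simp: x_def)
  have old: "(v1, x1) \<notin> z" if "z \<in> Q s - {q}" for z
    using I(9)[OF q(1) _ q(2) _ q(3)] that by blast
  show "round_inv N S T (Q(s := insert x (Q s - {q}))) t" (is "round_inv N S T ?Q t")
  proof (rule round_invI)
    show "1 \<le> T v \<and> T v \<le> t v" if "v \<in> {1..N}" for v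
      using I(1,2)[OF that] by auto
    show "finite (?Q s')" for s' using I(3) by simp
    show "z \<noteq> {}" if "z \<in> ?Q s'" for s' z
      using that I(4)[of z s'] by (auto simp: x_def split: if_splits)
    show "v \<in> {1..N} \<and> 1 \<le> y \<and> y \<le> t v" if "z \<in> ?Q s'" "(v, y) \<in> z" for s' z v y
    proof (cases "z = x")
      case True
      then show ?thesis using x_bound that by blast
    next
      case False
      then have z: "z \<in> Q s'" using that by (auto split: if_splits)
      then show ?thesis using I(5,6,7)[OF z that(2)] by blast
    qed
    show "y' \<le> T v'" if "z \<in> ?Q s'" "(v, y) \<in> z" "T v < y" "(v', y') \<in> z" "(v', y') \<noteq> (v, y)"
      for s' z v y v' y'
    proof (cases "z = x")
      case True
      then show ?thesis using that x_fresh by (metis not_less)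
    next
      case False
      then have z: "z \<in> Q s'" using that by (auto split: if_splits)
      then show ?thesis using I(8) that(2-5) by blast
    qed
    show "z = z'" if z: "z \<in> ?Q s'" "z' \<in> ?Q s'" "(v, y) \<in> z" "(v, y) \<in> z'" "T v < y"
      for s' z z' v y
    proof (cases "s' = s \<and> (z = x \<or> z' = x)")
      case True
      then have "v = v1 \<and> y = x1" using x_fresh z by blast
      then have "z \<notin> Q s - {q}" "z' \<notin> Q s - {q}" using old z(3,4) by auto
      then show ?thesis using True z by auto
    next
      case False
      then have "z \<in> Q s'" "z' \<in> Q s'" using z by (auto split: if_splits)
      then show ?thesis using I(9) z by blast
    qed
    show "\<exists>s\<in>{1..S}. \<exists>z\<in>?Q s. (v, y) \<in> z" if vy: "v \<in> {1..N}" "T v < y" "y \<le> t v" for v y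
    proof -
      obtain s' z where z: "s' \<in> {1..S}" "z \<in> Q s'" "(v, y) \<in> z" using I(10)[OF vy] by blast
      show ?thesis
      proof (cases "s' = s \<and> z = q")
        case True
        \<comment> \<open>The only fresh position that \<open>q\<close> could have covered is the
          one passed on to \<open>x\<close>.\<close>
        then have "(v, y) = (v1, x1)" using I(8)[OF q(1-3), of v y] z vy by force
        then show ?thesis using s by (intro bexI[of _ s]) (auto simp: x_def)
      next
        case False
        then show ?thesis using z by (intro bexI[of _ s'] bexI[of _ z]) auto
      qed
    qed
    \<comment> \<open>The removed \<open>q\<close> has a position above \<open>T\<close> and
      therefore never counted for decoding.\<close>
    show "decodable N S ?Q T" using q(2,3) by (intro decodable_mono[OF I(11)]) force
  qed
qed

text \<open>Step (b) amounts to replacing \<open>q'\<close> by the new query with the same fresh position,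
  followed by adding the modified \<open>q'\<close> with a new fresh position of file \<open>i\<close>.\<close>

lemma qstep_round_inv:
  assumes step: "qstep tau T s i (Q, t, \<C>, \<T>) (Q', t', \<C>', \<T>')"
    and tau: "tau_rule tau" and s: "s \<in> {1..S}" and i: "i \<in> {1..N}"
    and inv: "round_inv N S T Q t" and \<C>: "\<forall>U\<in>#\<C>. U \<subseteq> {1..N}"
  shows "round_inv N S T Q' t' \<and> t' = t(i := t i + 1) \<and> card (Q' s) = card (Q s) + 1
    \<and> (\<forall>s'. s' \<noteq> s \<longrightarrow> Q' s' = Q s') \<and> (\<forall>U\<in>#\<C>'. U \<subseteq> {1..N})"
proof -
  have tauT: "1 \<le> tau T st U u \<and> tau T st U u \<le> T u" if "u \<in> {1..N}" for st U u
  proof -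
    have "tau T st U u \<in> {1..T u}"
      using tau round_invD(1)[OF inv that] unfolding tau_rule_def by blast
    then show ?thesis by simp
  qed
  have R: "v \<in> {1..N} \<and> 1 \<le> y \<and> y \<le> T v"
    if "(v, y) \<in> {(u, tau T st U u) | u. u \<in> U - {w}}" "U \<in># \<C>" for v y w st U
  proof -
    have "v \<in> {1..N}" "y = tau T st U v" using that \<C> by blast+
    then show ?thesis using tauT by blast
  qed
  from step show ?thesis
  proof cases
    case (step_a U new)
    note 1 = round_inv_add_query[OF inv s i R[where st = "(Q, t, \<C>, \<T>)" and w = i, OF _ step_a(5)] step_a(7)]
    have "\<forall>U\<in>#\<C>'. U \<subseteq> {1..N}" using \<C> step_a(3) by (meson in_diffD)
    then show ?thesis using 1 unfolding step_a(1,2) by simp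
  next
    case (step_b U V q' v1 x new q'')
    have \<C>': "\<forall>U\<in>#\<C>'. U \<subseteq> {1..N}" using \<C> step_b(3) by (meson in_diffD)
    \<comment> \<open>In step (b) no set left in \<open>\<C>\<close> contains \<open>i\<close>,
      whereas \<open>v1\<close> lies in such a set.\<close>
    have v1: "v1 \<in> {1..N}" "v1 \<noteq> i" using step_b(5,6,10) \<C> by blast+
    let ?Q = "Q(s := insert new (Q s - {q'}))"
    note 1 = round_inv_replace_query[OF inv s R[where st = "(Q, t, \<C>, \<T>)" and w = v1, OF _ step_b(6)] step_b(8,12,13,14)]
    \<comment> \<open>The part of \<open>q''\<close> without its new fresh position. Since the only
      fresh position of \<open>q'\<close> was that of \<open>v1\<close>, everything kept from
      \<open>q'\<close> is old.\<close>
    let ?R = "{(v, y). (v, y) \<in> q' \<and> v \<noteq> i \<and> v \<noteq> v1} \<union> {(v1, tau T (Q, t, \<C>, \<T>) U v1)}"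
    have R': "v \<in> {1..N} \<and> 1 \<le> y \<and> y \<le> T v" if vy: "(v, y) \<in> ?R" for v y
    proof (cases "v = v1")
      case True
      then have "y = tau T (Q, t, \<C>, \<T>) U v1" using vy by simp
      then show ?thesis using True tauT[OF v1(1)] v1 by simp
    next
      case False
      then have "(v, y) \<in> q'" "(v, y) \<noteq> (v1, x)" using vy by auto
      then show ?thesis
        using round_invD(5,6)[OF inv step_b(8)] round_invD(8)[OF inv step_b(8,12,13)] by blast
    qed
    have q'': "q'' = insert (i, t i + 1) ?R" unfolding step_b(15) by blast
    note 2 = round_inv_add_query[OF 1(1) s i R' q'']
    have "?Q(s := insert q'' (?Q s)) = Q'"
      unfolding step_b(1) by (simp add: insert_commute)
    moreover have "card (Q' s) = card (Q s) + 1"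
      using 1(2) 2(2) unfolding step_b(1) by (simp add: insert_commute)
    ultimately show ?thesis using 2(1) \<C>' unfolding step_b(1,2) by simp
  qed
qed

lemma qsteps_round_inv:
  assumes "(qstep tau T s i ^^ n) (Q, t, \<C>, \<T>) (Q', t', \<C>', \<T>')"
    and "tau_rule tau" "s \<in> {1..S}" "i \<in> {1..N}"
    and "round_inv N S T Q t" "\<forall>U\<in>#\<C>. U \<subseteq> {1..N}"
  shows "round_inv N S T Q' t' \<and> (\<forall>v. t' v = (if v = i then t v + n else t v)) \<and> card (Q' s) = card (Q s) + n
    \<and> (\<forall>s'. s' \<noteq> s \<longrightarrow> Q' s' = Q s') \<and> (\<forall>U\<in>#\<C>'. U \<subseteq> {1..N})"
  using assms(1)
proof (induction n arbitrary: Q' t' \<C>' \<T>')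
  case 0
  then show ?case using assms by simp
next
  case (Suc n)
  then obtain Q1 t1 \<C>1 \<T>1 where
    1: "(qstep tau T s i ^^ n) (Q, t, \<C>, \<T>) (Q1, t1, \<C>1, \<T>1)"
    and 2: "qstep tau T s i (Q1, t1, \<C>1, \<T>1) (Q', t', \<C>', \<T>')"
    by (auto elim!: relcomppE)
  note IH = Suc.IH[OF 1]
  then have "round_inv N S T Q1 t1" "\<forall>U\<in>#\<C>1. U \<subseteq> {1..N}" by blast+
  note step = qstep_round_inv[OF 2 assms(2-4) this]
  from step IH have "\<forall>v. t' v = (if v = i then t v + Suc n else t v)"
    and "card (Q' s) = card (Q s) + Suc n" and "\<forall>s'. s' \<noteq> s \<longrightarrow> Q' s' = Q s'" by simp_all
  with step show ?case by blast
qed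

lemma qblock_round_inv:
  assumes "qblock N S tau d k T s (Q, t) (Q', t')"
    and "tau_rule tau" "s \<in> {1..S}" "round_inv N S T Q t"
  shows "round_inv N S T Q' t'
    \<and> (\<forall>v\<in>{1..N}. t' v = t v + fresh_count N S s v d k)
    \<and> card (Q' s) = card (Q s) + (\<Sum>v = 1..N. fresh_count N S s v d k)
    \<and> (\<forall>s'. s' \<noteq> s \<longrightarrow> Q' s' = Q s')"
proof -
  let ?F = "\<lambda>v. fresh_count N S s v d k"
  define \<C> where "\<C> = repeat_mset (psi N S s k) (mset_set {U. U \<subseteq> {1..N} \<and> card U = k})"
  have \<C>: "\<forall>U\<in>#\<C>. U \<subseteq> {1..N}"
  proof
    fix U assume "U \<in># \<C>"
    then have "U \<in># mset_set {U. U \<subseteq> {1..N} \<and> card U = k}"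
      unfolding \<C>_def by (metis count_repeat_mset count_greater_zero_iff mult_0_right neq0_conv)
    then show "U \<subseteq> {1..N}" by simp
  qed
  obtain \<C>' \<T>' where loop: "for_loop (\<lambda>i. qstep tau T s i ^^ ?F i) [1..<N + 1]
      (Q, t, \<C>, {#}) (Q', t', \<C>', \<T>')"
    using assms(1) unfolding qblock_def \<C>_def by auto
  define P where "P A st \<longleftrightarrow> (case st of (Q1, t1, \<C>1, \<T>1 :: nat set multiset) \<Rightarrow> finite A \<and>
      round_inv N S T Q1 t1 \<and> (\<forall>v. t1 v = t v + (if v \<in> A then ?F v else 0))
    \<and> card (Q1 s) = card (Q s) + sum ?F A \<and> (\<forall>s'. s' \<noteq> s \<longrightarrow> Q1 s' = Q s')
    \<and> (\<forall>U\<in>#\<C>1. U \<subseteq> {1..N}))"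
    for A and st :: qstate
  have "P (set [1..<N + 1]) (Q', t', \<C>', \<T>')"
    using loop
  proof (rule for_loop_invariant)
    show "distinct [1..<N + 1]" by (rule distinct_upt)
    show "P {} (Q, t, \<C>, {#})" using assms \<C> by (simp add: P_def)
    fix A i st st'
    assume i: "i \<in> set [1..<N + 1] - A" and P: "P A st" and step: "(qstep tau T s i ^^ ?F i) st st'"
    obtain Q1 t1 \<C>1 \<T>1 where st: "st = (Q1, t1, \<C>1, \<T>1)" by (metis surj_pair)
    obtain Q2 t2 \<C>2 \<T>2 where st': "st' = (Q2, t2, \<C>2, \<T>2)" by (metis surj_pair)
    have i': "i \<in> {1..N}" "i \<notin> A" using i by (auto simp del: upt_Suc)
    note P' = P[unfolded P_def st prod.case]
    have "round_inv N S T Q1 t1" "\<forall>U\<in>#\<C>1. U \<subseteq> {1..N}" using P' by blast+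
    note 1 = qsteps_round_inv[OF step[unfolded st st'] assms(2,3) i'(1) this]
    have t2: "\<forall>v. t2 v = t v + (if v \<in> insert i A then ?F v else 0)"
    proof
      fix v
      have "t2 v = (if v = i then t1 v + ?F i else t1 v)" using 1 by blast
      moreover have "t1 v = t v + (if v \<in> A then ?F v else 0)" using P' by blast
      ultimately show "t2 v = t v + (if v \<in> insert i A then ?F v else 0)" using i'(2) by (cases "v = i") simp_all
    qed
    moreover have "card (Q2 s) = card (Q s) + sum ?F (insert i A)" using 1 P' i'(2) by simp
    moreover have "\<forall>s'. s' \<noteq> s \<longrightarrow> Q2 s' = Q s'" using 1 P' by simp
    moreover have "finite (insert i A)" using P' by blast
    ultimately show "P (insert i A) st'" unfolding P_def st' prod.case using 1 by blast
  qed
  then show ?thesis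
    by (simp add: P_def atLeastLessThanSuc_atLeastAtMost del: upt_Suc)
qed

lemma sum_eq_imp_term_eq:
  fixes f f' :: "'a \<Rightarrow> 'b :: cancel_comm_monoid_add"
  assumes "finite A" "a \<in> A" "sum f A = sum f' A" "\<And>b. b \<in> A - {a} \<Longrightarrow> f b = f' b"
  shows "f a = f' a"
proof -
  have "f a + sum f (A - {a}) = f' a + sum f' (A - {a})"
    using assms(1-3) by (simp add: sum.remove)
  also have "sum f' (A - {a}) = sum f (A - {a})" using assms(4) by (intro sum.cong) auto
  finally show ?thesis by simp
qed

lemma round_inv_end:
  assumes inv: "round_inv N S T Q t"
  shows "round_inv N S t Q t"
proof (rule round_invI)
  note I = round_invD[OF inv]
  show "1 \<le> t v \<and> t v \<le> t v" if "v \<in> {1..N}" for v using I(1,2)[OF that] by simp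
  show "finite (Q s)" for s by (rule I(3))
  show "x \<noteq> {}" if "x \<in> Q s" for x s using I(4)[OF that] .
  show "v \<in> {1..N} \<and> 1 \<le> y \<and> y \<le> t v" if "x \<in> Q s" "(v, y) \<in> x" for x s v y
    using I(5-7)[OF that] by blast
  show "y' \<le> t v'" if "x \<in> Q s" "(v, y) \<in> x" "t v < y" "(v', y') \<in> x" for s x v y v' y'
    using I(7)[OF that(1,4)] .
  show "x = x'" if "x \<in> Q s" "(v, y) \<in> x" "t v < y" for s x x' v y
    using I(7)[OF that(1,2)] that(3) by simp
  show "\<exists>s\<in>{1..S}. \<exists>x\<in>Q s. (v, y) \<in> x" if "t v < y" "y \<le> t v" for v y
    using that by simp
  show "decodable N S Q t"
    unfolding decodable_def
  proof (intro allI impI)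
    fix f f' :: "nat \<times> nat \<Rightarrow> bit"
    assume *: "\<forall>s\<in>{1..S}. \<forall>x\<in>Q s. (\<forall>(v, y)\<in>x. y \<le> t v) \<longrightarrow> sum f x = sum f' x"
    have eq: "sum f x = sum f' x" if "s \<in> {1..S}" "x \<in> Q s" for s x
      using * that I(7)[OF that(2)] by blast
    have "\<forall>v\<in>{1..N}. \<forall>y\<in>{1..T v}. f (v, y) = f' (v, y)"
      using I(11)[unfolded decodable_def, THEN spec, THEN spec, THEN mp, of f f'] eq by blast
    then have old: "f (v, y) = f' (v, y)" if "v \<in> {1..N}" "1 \<le> y" "y \<le> T v" for v y
      using that by simp
    show "\<forall>v\<in>{1..N}. \<forall>y\<in>{1..t v}. f (v, y) = f' (v, y)"
    proof (intro ballI)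
      fix v y assume v: "v \<in> {1..N}" and y: "y \<in> {1..t v}"
      show "f (v, y) = f' (v, y)"
      proof (cases "y \<le> T v")
        case False
        then obtain s x where x: "s \<in> {1..S}" "x \<in> Q s" "(v, y) \<in> x"
          using I(10)[OF v, of y] y by auto
        have "f z = f' z" if z: "z \<in> x - {(v, y)}" for z
        proof -
          obtain v' y' where vy: "z = (v', y')" by fastforce
          then have "y' \<le> T v'" using I(8)[OF x(2,3)] False z by auto
          moreover have "v' \<in> {1..N}" "1 \<le> y'" using I(5,6)[OF x(2), of v' y'] z vy by blast+
          ultimately show ?thesis unfolding vy by (rule old[rotated 2])
        qed
        moreover have "finite x"
        proof (rule finite_subset)
          show "x \<subseteq> (SIGMA v:{1..N}. {..t v})" using I(5,7)[OF x(2)] by auto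
        qed simp
        ultimately show ?thesis using sum_eq_imp_term_eq[OF _ x(3) eq[OF x(1,2)]] by blast
      next
        case True
        then show ?thesis using old[OF v, of y] y by simp
      qed
    qed
  qed
qed

lemma qround_round_inv:
  assumes "qround N S tau d k (Q, t) (Q', t')" "tau_rule tau" "round_inv N S t Q t"
  shows "round_inv N S t' Q' t'
    \<and> (\<forall>v\<in>{1..N}. t' v = t v + (\<Sum>s = 1..S. fresh_count N S s v d k))
    \<and> (\<forall>s\<in>{1..S}. card (Q' s) = card (Q s) + (\<Sum>v = 1..N. fresh_count N S s v d k))"
proof -
  define P where "P A st \<longleftrightarrow> (case st of (Q1, t1) \<Rightarrow> finite A \<and> round_inv N S t Q1 t1
    \<and> (\<forall>v\<in>{1..N}. t1 v = t v + (\<Sum>s\<in>A. fresh_count N S s v d k))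
    \<and> (\<forall>s. card (Q1 s) = card (Q s) + (if s \<in> A then \<Sum>v = 1..N. fresh_count N S s v d k else 0)))"
    for A and st :: "(nat \<Rightarrow> pos_query set) \<times> (nat \<Rightarrow> nat)"
  have "P (set [1..<S + 1]) (Q', t')"
    using assms(1)[unfolded qround_def prod.case]
  proof (rule for_loop_invariant)
    show "distinct [1..<S + 1]" by (rule distinct_upt)
    show "P {} (Q, t)" using assms by (simp add: P_def)
    fix A s st st'
    assume s: "s \<in> set [1..<S + 1] - A" and P: "P A st" and step: "qblock N S tau d k t s st st'"
    obtain Q1 t1 where st: "st = (Q1, t1)" by fastforce
    obtain Q2 t2 where st': "st' = (Q2, t2)" by fastforce
    have s': "s \<in> {1..S}" "s \<notin> A" using s by (auto simp del: upt_Suc)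
    note P' = P[unfolded P_def st prod.case]
    have "round_inv N S t Q1 t1" using P' by blast
    note 1 = qblock_round_inv[OF step[unfolded st st'] assms(2) s'(1) this]
    have "\<forall>v\<in>{1..N}. t2 v = t v + (\<Sum>s\<in>insert s A. fresh_count N S s v d k)"
      using 1 P' s'(2) by simp
    moreover have "\<forall>s'. card (Q2 s') = card (Q s')
        + (if s' \<in> insert s A then \<Sum>v = 1..N. fresh_count N S s' v d k else 0)"
    proof
      fix s'
      have "card (Q2 s') = card (Q1 s') + (if s' = s then \<Sum>v = 1..N. fresh_count N S s' v d k else 0)"
        using 1 by (cases "s' = s") simp_all
      moreover have "card (Q1 s') = card (Q s')
          + (if s' \<in> A then \<Sum>v = 1..N. fresh_count N S s' v d k else 0)"
        using P' by blast
      ultimately show "card (Q2 s') = card (Q s')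
          + (if s' \<in> insert s A then \<Sum>v = 1..N. fresh_count N S s' v d k else 0)"
        using s'(2) by (cases "s' = s") simp_all
    qed
    moreover have "finite (insert s A)" using P' by blast
    ultimately show "P (insert s A) st'" unfolding P_def st' prod.case using 1 by blast
  qed
  then show ?thesis using round_inv_end[of N S t Q' t']
    by (simp add: P_def atLeastLessThanSuc_atLeastAtMost del: upt_Suc)
qed

lemma qinit_round_inv:
  assumes "S \<ge> 1" "qinit N = (Q, t)"
  shows "round_inv N S t Q t"
proof -
  have Q: "Q = (\<lambda>s. if s = 1 then {{(i, 1)} | i. i \<in> {1..N}} else {})" and t: "t = (\<lambda>i. 1)"
    using assms(2) by (auto simp: qinit_def)
  have mem: "x \<in> Q s \<longleftrightarrow> s = 1 \<and> (\<exists>i\<in>{1..N}. x = {(i, 1)})" for x s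
    unfolding Q by auto
  show ?thesis
  proof (rule round_invI)
    show "finite (Q s)" for s by (simp add: Q)
    show "x \<noteq> {}" if "x \<in> Q s" for x s using that by (auto simp: mem)
    show "v \<in> {1..N} \<and> 1 \<le> y \<and> y \<le> t v" if "x \<in> Q s" "(v, y) \<in> x" for x s v y
      using that by (auto simp: mem t)
    show "y' \<le> t v'" if "x \<in> Q s" "(v', y') \<in> x" for s x v' y'
      using that by (auto simp: mem t)
    show "x = x'" if "x \<in> Q s" "(v, y) \<in> x" "t v < y" for s x x' v y
      using that by (auto simp: mem t)
    show "\<exists>s\<in>{1..S}. \<exists>x\<in>Q s. (v, y) \<in> x" if "t v < y" "y \<le> t v" for v y
      using that by simp
    show "decodable N S Q t"
      unfolding decodable_def
    proof (intro allI impI ballI)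
      fix f f' :: "nat \<times> nat \<Rightarrow> bit" and i y
      assume *: "\<forall>s\<in>{1..S}. \<forall>x\<in>Q s. (\<forall>(v, y)\<in>x. y \<le> t v) \<longrightarrow> sum f x = sum f' x"
        and i: "i \<in> {1..N}" and y: "y \<in> {1..t i}"
      have "{(i, 1)} \<in> Q 1" using i by (auto simp: mem)
      moreover have "1 \<in> {1..S}" using assms(1) by simp
      ultimately have "(\<forall>(v, y)\<in>{(i, 1)}. y \<le> t v) \<longrightarrow> sum f {(i, 1)} = sum f' {(i, 1)}"
        using * by blast
      then have "sum f {(i, 1)} = sum f' {(i, 1)}" unfolding t by blast
      then have "f (i, 1) = f' (i, 1)" by (rule sum_eq_imp_term_eq[rotated 2]) blast+
      moreover have "y = 1" using y by (simp add: t)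
      ultimately show "f (i, y) = f' (i, y)" by simp
    qed
  qed (simp add: t)
qed

lemma QSet1_positions:
  assumes "S \<ge> 2" "N \<ge> 2" "d \<in> {1..N}" "tau_rule tau"
    and loop: "for_loop (qround N S tau d) [2..<N + 1] (qinit N) (Q, t)"
  shows "round_inv N S t Q t"
    and "\<And>i. i \<in> {1..N} \<Longrightarrow> t i = (if i = d then H_par N S else S ^ (N - 1))"
    and "(\<Sum>s = 1..S. card (Q s)) = num_queries N S"
proof -
  obtain Q0 t0 where init: "qinit N = (Q0, t0)" by fastforce
  define P where "P A st \<longleftrightarrow> (case st of (Q1, t1) \<Rightarrow> finite A \<and> round_inv N S t1 Q1 t1
    \<and> (\<forall>v\<in>{1..N}. t1 v = t0 v + (\<Sum>k\<in>A. \<Sum>s = 1..S. fresh_count N S s v d k))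
    \<and> (\<forall>s\<in>{1..S}. card (Q1 s) = card (Q0 s) + (\<Sum>k\<in>A. \<Sum>v = 1..N. fresh_count N S s v d k)))"
    for A and st :: "(nat \<Rightarrow> pos_query set) \<times> (nat \<Rightarrow> nat)"
  have "P (set [2..<N + 1]) (Q, t)"
    using loop
  proof (rule for_loop_invariant)
    show "distinct [2..<N + 1]" by (rule distinct_upt)
    show "P {} (qinit N)" using qinit_round_inv[OF _ init] assms(1) by (simp add: P_def init)
    fix A k st st'
    assume k: "k \<in> set [2..<N + 1] - A" and P: "P A st" and step: "qround N S tau d k st st'"
    obtain Q1 t1 where st: "st = (Q1, t1)" by fastforce
    obtain Q2 t2 where st': "st' = (Q2, t2)" by fastforce
    note P' = P[unfolded P_def st prod.case]
    have "round_inv N S t1 Q1 t1" using P' by blast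
    note 1 = qround_round_inv[OF step[unfolded st st'] assms(4) this]
    have "\<forall>v\<in>{1..N}. t2 v = t0 v + (\<Sum>k\<in>insert k A. \<Sum>s = 1..S. fresh_count N S s v d k)"
      using 1 P' k by simp
    moreover have "\<forall>s\<in>{1..S}. card (Q2 s)
        = card (Q0 s) + (\<Sum>k\<in>insert k A. \<Sum>v = 1..N. fresh_count N S s v d k)"
      using 1 P' k by simp
    moreover have "finite (insert k A)" using P' by blast
    ultimately show "P (insert k A) st'" unfolding P_def st' prod.case using 1 by blast
  qed
  moreover have "set [2..<N + 1] = {2..N}" by auto
  ultimately have P: "P {2..N} (Q, t)" by simp
  then show "round_inv N S t Q t" by (simp add: P_def)
  show "t i = (if i = d then H_par N S else S ^ (N - 1))" if "i \<in> {1..N}" for i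
  proof -
    have "t i = 1 + (\<Sum>k = 2..N. \<Sum>s = 1..S. fresh_count N S s i d k)"
      using P init that by (auto simp: P_def qinit_def)
    then show ?thesis
      using final_counter_eq[OF assms(1,2), of d] final_counter_neq[OF assms(1,2), of i d] by auto
  qed
  have "(\<Sum>s = 1..S. card (Q s)) = (\<Sum>s = 1..S. card (Q0 s)
      + (\<Sum>k = 2..N. (N choose k) * psi N S s k))"
    using P sum_fresh_count[OF assms(1) _ _ assms(3)] assms(2) by (simp add: P_def)
  also have "\<dots> = (\<Sum>s = 1..S. card (Q0 s))
      + (\<Sum>k = 2..N. \<Sum>s = 1..S. (N choose k) * psi N S s k)"
    by (simp add: sum.distrib sum.swap[of _ "{2..N}"])
  also have "(\<Sum>s = 1..S. card (Q0 s)) = N"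
  proof -
    have "{{(i, 1 :: nat)} | i. i \<in> {1..N}} = (\<lambda>i. {(i, 1)}) ` {1..N}" by blast
    then have Q0: "Q0 = (\<lambda>s. if s = 1 then (\<lambda>i. {(i, 1)}) ` {1..N} else {})"
      using init unfolding qinit_def by (simp only: prod.inject)
    have "(\<Sum>s = 1..S. card (Q0 s)) = (\<Sum>s = 1..S. if s = 1 then N else 0)"
      by (intro sum.cong) (auto simp: Q0 card_image inj_on_def)
    then show ?thesis using assms(1) by simp
  qed
  finally show "(\<Sum>s = 1..S. card (Q s)) = num_queries N S"
    using num_queries_split[OF assms(1,2)] by simp
qed

section \<open>Decoding and counting bits\<close>

text \<open>Passing from positions to subsubfiles is injective because every \<open>a i\<close> is.
  Hence neither symbols within a query nor whole queries merge, and sums and cardinalities carry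
  over.\<close>

lemma QSet1_queries:
  assumes S: "S \<ge> 2" and N: "N \<ge> 2" and d: "d \<in> {1..N}" and tau: "tau_rule tau"
    and a: "\<And>i. i \<in> {1..N} \<Longrightarrow> inj (a i)"
    and Q': "Q' \<in> QSet1 N S tau j a d"
  shows "finite (Q' s)"
    and "x \<in> Q' s \<Longrightarrow> x \<noteq> {} \<and> (\<forall>(i, j', \<tau>)\<in>x. j' = j)"
    and "(\<Sum>s = 1..S. card (Q' s)) = num_queries N S"
    and "\<And>(g :: symbol \<Rightarrow> bit) g' i \<tau>. (\<And>s x. s \<in> {1..S} \<Longrightarrow> x \<in> Q' s \<Longrightarrow> sum g x = sum g' x) \<Longrightarrow>
      i \<in> {1..N} \<Longrightarrow> \<tau> \<in> {1..(if i = d then H_par N S else S ^ (N - 1))} \<Longrightarrow>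
      g (i, j, a i \<tau>) = g' (i, j, a i \<tau>)"
proof -
  define \<phi> where "\<phi> = (\<lambda>(i, \<tau>). (i, j, a i \<tau>))"
  obtain Q t where loop: "for_loop (qround N S tau d) [2..<N + 1] (qinit N) (Q, t)"
    and Q'_eq: "Q' = (\<lambda>s. (\<lambda>q. \<phi> ` q) ` Q s)"
    using Q' unfolding QSet1_def \<phi>_def mem_Collect_eq by (elim exE conjE)
  note R = QSet1_positions[OF S N d tau loop]
  note I = round_invD[OF R(1)]
  have inj: "inj_on \<phi> ({1..N} \<times> UNIV)"
  proof (rule inj_onI)
    fix y z assume yz: "y \<in> {1..N} \<times> (UNIV :: nat set)" "\<phi> y = \<phi> z"
    obtain i \<tau> i' \<tau>' where y: "y = (i, \<tau>)" and z: "z = (i', \<tau>')" by fastforce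
    have ii: "i = i'" using yz(2) unfolding y z \<phi>_def by simp
    have "a i \<tau> = a i \<tau>'" using yz(2) unfolding y z \<phi>_def ii by simp
    moreover have "i \<in> {1..N}" using yz(1) unfolding y by simp
    ultimately show "y = z" using injD[OF a] ii unfolding y z by blast
  qed
  have sub: "x \<subseteq> {1..N} \<times> UNIV" if "x \<in> Q s" for x s
    using I(5)[OF that] by auto
  have inj_x: "inj_on \<phi> x" if "x \<in> Q s" for x s
    using inj sub[OF that] by (rule inj_on_subset)
  show "finite (Q' s)" using I(3) by (simp add: Q'_eq)
  show "x \<noteq> {} \<and> (\<forall>(i, j', \<tau>)\<in>x. j' = j)" if x: "x \<in> Q' s"
  proof -
    obtain y where "y \<in> Q s" "x = \<phi> ` y" using x unfolding Q'_eq by blast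
    then show ?thesis using I(4) by (auto simp: \<phi>_def)
  qed
  have "card (Q' s) = card (Q s)" for s
  proof -
    have "\<Union>(Q s) \<subseteq> {1..N} \<times> UNIV" using sub by blast
    then have "inj_on ((`) \<phi>) (Q s)" using inj by (intro inj_on_image) (rule inj_on_subset)
    then show ?thesis unfolding Q'_eq by (rule card_image)
  qed
  then show "(\<Sum>s = 1..S. card (Q' s)) = num_queries N S" using R(3) by simp
  fix g g' :: "symbol \<Rightarrow> bit" and i \<tau>
  assume eq: "\<And>s x. s \<in> {1..S} \<Longrightarrow> x \<in> Q' s \<Longrightarrow> sum g x = sum g' x"
    and i: "i \<in> {1..N}" and \<tau>: "\<tau> \<in> {1..(if i = d then H_par N S else S ^ (N - 1))}"
  have "sum (g \<circ> \<phi>) x = sum (g' \<circ> \<phi>) x" if "s \<in> {1..S}" "x \<in> Q s" for s x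
  proof -
    have "\<phi> ` x \<in> Q' s" using that by (simp add: Q'_eq)
    then have "sum g (\<phi> ` x) = sum g' (\<phi> ` x)" using eq that(1) by blast
    then show ?thesis using inj_x[OF that(2)] by (simp only: sum.reindex)
  qed
  then have "\<forall>i\<in>{1..N}. \<forall>y\<in>{1..t i}. (g \<circ> \<phi>) (i, y) = (g' \<circ> \<phi>) (i, y)"
    by (intro I(11)[unfolded decodable_def, THEN spec, THEN spec, THEN mp] ballI impI)
  moreover have "\<tau> \<in> {1..t i}" using \<tau> R(2)[OF i] by simp
  ultimately have "(g \<circ> \<phi>) (i, \<tau>) = (g' \<circ> \<phi>) (i, \<tau>)" using i by blast
  then show "g (i, j, a i \<tau>) = g' (i, j, a i \<tau>)" by (simp only: \<phi>_def comp_def prod.case)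
qed

text \<open>Reduces recovery to injectivity: the decoder picks any files consistent with both
  observations and returns their target.\<close>

lemma exists_decoder:
  assumes "\<And>W W'. W \<in> F \<Longrightarrow> W' \<in> F \<Longrightarrow> obs W = obs W' \<Longrightarrow> obs' W = obs' W' \<Longrightarrow> target W = target W'"
  shows "\<exists>dec. \<forall>W\<in>F. dec (obs W) (obs' W) = target W"
proof (intro exI ballI)
  fix W assume "W \<in> F"
  then have "\<exists>W'. W' \<in> F \<and> obs W' = obs W \<and> obs' W' = obs' W" by blast
  then have "(SOME W'. W' \<in> F \<and> obs W' = obs W \<and> obs' W' = obs' W) \<in> F
      \<and> obs (SOME W'. W' \<in> F \<and> obs W' = obs W \<and> obs' W' = obs' W) = obs W
      \<and> obs' (SOME W'. W' \<in> F \<and> obs W' = obs W \<and> obs' W' = obs' W) = obs' W"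
    by (rule someI_ex)
  then show "(\<lambda>o1 o2. target (SOME W'. W' \<in> F \<and> obs W' = o1 \<and> obs' W' = o2)) (obs W) (obs' W) = target W"
    using assms \<open>W \<in> F\<close> by blast
qed

lemma xor_sum_eqD:
  assumes "xor_sum N S K L W x = xor_sum N S K L W' x" "b < block_size N S K L"
  shows "(\<Sum>y\<in>x. subsubfile N S K L W y ! b) = (\<Sum>y\<in>x. subsubfile N S K L W' y ! b)"
  using arg_cong[OF assms(1), of "\<lambda>l. l ! b"] assms(2) unfolding xor_sum_def by simp

lemma file_determined_by_subsubfiles:
  assumes len: "length (W i) = L" "length (W' i) = L" and dvd: "K * S ^ (N - 1) dvd L"
    and eq: "\<And>j t b. j \<in> {1..K} \<Longrightarrow> t \<in> {1..S ^ (N - 1)} \<Longrightarrow> b < block_size N S K L \<Longrightarrow>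
      subsubfile N S K L W (i, j, t) ! b = subsubfile N S K L W' (i, j, t) ! b"
  shows "W i = W' i"
proof (rule nth_equalityI)
  show "length (W i) = length (W' i)" using len by simp
  fix n assume n: "n < length (W i)"
  let ?B = "block_size N S K L" and ?n = "S ^ (N - 1)"
  have L: "L = K * ?n * ?B" using dvd by (simp add: block_size_def)
  then have "0 < K * ?n * ?B" using n len by simp
  then have pos: "?B > 0" "?n > 0" by (simp_all only: nat_0_less_mult_iff)
  \<comment> \<open>Mixed radix: bit \<open>n\<close> lies at offset \<open>b\<close> of block
    \<open>m\<close>, and \<open>m\<close> splits into the zero-based subfile and subsubfile
    numbers, hence the \<open>Suc\<close> below.\<close>
  define m b where "m = n div ?B" and "b = n mod ?B"
  have mb: "n = m * ?B + b" "b < ?B" using pos by (auto simp: m_def b_def)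
  have "m < K * ?n" unfolding m_def using n len L by (simp add: less_mult_imp_div_less)
  then have j: "Suc (m div ?n) \<in> {1..K}" by (simp add: Suc_le_eq less_mult_imp_div_less)
  have t: "Suc (m mod ?n) \<in> {1..?n}" using pos by (simp add: Suc_le_eq)
  have nth: "subsubfile N S K L V (i, Suc (m div ?n), Suc (m mod ?n)) ! b = V i ! n"
    if "length (V i) = L" for V
  proof -
    have "m * ?B \<le> length (V i)" using n len that mb by simp
    moreover have "m div ?n * ?n + m mod ?n = m" by (rule div_mult_mod_eq)
    ultimately show ?thesis using mb by (simp add: subsubfile_def)
  qed
  show "W i ! n = W' i ! n" using eq[OF j t mb(2)] len by (simp only: nth)
qed

lemma file_sum_eqD:
  assumes "N \<ge> 1" "file_sum N j t = file_sum N j' t'"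
  shows "j = j' \<and> t = t'"
proof -
  have "(1, j, t) \<in> file_sum N j t" using assms(1) by (simp add: file_sum_def)
  then have "(1, j, t) \<in> file_sum N j' t'" unfolding assms(2) .
  then show ?thesis by (simp add: file_sum_def)
qed

lemma cached_eq:
  assumes "N \<ge> 1" "p u \<in> {1..K}"
  shows "cached N S K p u = file_sum N (p u) ` {H_par N S + 1..S ^ (N - 1)}"
proof (intro equalityI subsetI)
  fix x assume "x \<in> cached N S K p u"
  then obtain j t t' where "x = file_sum N j t" "t \<in> {H_par N S + 1..S ^ (N - 1)}"
    "x = file_sum N (p u) t'"
    unfolding cached_def broadcast_def by blast
  then show "x \<in> file_sum N (p u) ` {H_par N S + 1..S ^ (N - 1)}"
    using file_sum_eqD[OF assms(1)] by blast
next
  fix x assume "x \<in> file_sum N (p u) ` {H_par N S + 1..S ^ (N - 1)}"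
  then show "x \<in> cached N S K p u"
    unfolding cached_def broadcast_def using assms(2) by blast
qed

text \<open>The cache holds \<open>S ^ (N - 1) - H_par N S\<close> blocks; substituting
  \<open>H_par\<close> turns this into \<open>N * S ^ (N - 1) - num_queries N S\<close>. Both bounds
  on \<open>num_queries\<close> ensure that the natural subtractions are exact.\<close>

lemma cache_bits_eq:
  assumes "S \<ge> 2" "N \<ge> 1" "p u \<in> {1..K}"
  shows "real (cache_bits N S K L p W u)
    = (real N * real S ^ (N - 1) - real (num_queries N S)) * real (block_size N S K L)"
proof -
  have "cache_bits N S K L p W u = card (cached N S K p u) * block_size N S K L"
    by (simp add: cache_bits_def contents_def xor_sum_def)
  also have "card (cached N S K p u) = S ^ (N - 1) - H_par N S"
    unfolding cached_eq[where p = p and u = u, OF assms(2,3)]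
    using file_sum_eqD[OF assms(2)] by (subst card_image) (auto intro: inj_onI)
  finally have "real (cache_bits N S K L p W u)
      = (real (S ^ (N - 1)) - real (H_par N S)) * real (block_size N S K L)"
    using H_par_le[OF assms(1,2)] by (simp add: of_nat_diff)
  also have "real (H_par N S) = real (num_queries N S) - (real N - 1) * real S ^ (N - 1)"
    unfolding H_par_def using num_queries_lower[OF assms(1,2)] assms(2) by (simp add: of_nat_diff)
  finally show ?thesis by (simp add: algebra_simps)
qed

lemma delivery_nonempty:
  assumes "S \<ge> 2" "d ` {1..K} \<subseteq> {1..N}"
  shows "delivery N S K tau p P d \<noteq> {}"
proof -
  have "\<exists>Qc. \<forall>c\<in>{1..K}. Qc c \<in> QSet1 N S (tau c) (p c) (P c) (d c)"
    using QSet1_nonempty[OF assms(1)] assms(2) by (intro bchoice) blast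
  then show ?thesis unfolding delivery_def by blast
qed

section \<open>Cost and correctness of a fixed outcome of the delivery phase\<close>

context
  fixes N S K L :: nat and d p :: "nat \<Rightarrow> nat" and P :: "nat \<Rightarrow> nat \<Rightarrow> nat \<Rightarrow> nat"
    and tau :: "nat \<Rightarrow> tau_choice" and Qc :: "nat \<Rightarrow> nat \<Rightarrow> symbol set set"
  assumes S: "S \<ge> 2" and N: "N \<ge> 2" and dvd: "K * S ^ (N - 1) dvd L"
    and d: "d ` {1..K} \<subseteq> {1..N}" "inj_on d {1..K}"
    and p: "p permutes {1..K}"
    and P: "valid_perms N S K d P"
    and tau: "\<And>c. c \<in> {1..K} \<Longrightarrow> tau_rule (tau c)"
    and Qc: "\<And>c. c \<in> {1..K} \<Longrightarrow> Qc c \<in> QSet1 N S (tau c) (p c) (P c) (d c)"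
begin

lemma P_permutes: "c \<in> {1..K} \<Longrightarrow> i \<in> {1..N} \<Longrightarrow> P c i permutes {1..S ^ (N - 1)}"
  using P by (simp add: valid_perms_def)

lemma d_mem: "c \<in> {1..K} \<Longrightarrow> d c \<in> {1..N}"
  using d(1) by blast

lemma P_inj: "c \<in> {1..K} \<Longrightarrow> i \<in> {1..N} \<Longrightarrow> inj (P c i)"
  using P_permutes permutes_inj by blast

lemma Qc_queries:
  assumes c: "c \<in> {1..K}"
  shows "finite (Qc c s)"
    and "x \<in> Qc c s \<Longrightarrow> x \<noteq> {}"
    and "x \<in> Qc c s \<Longrightarrow> (i, j, \<tau>) \<in> x \<Longrightarrow> j = p c"
    and "(\<Sum>s = 1..S. card (Qc c s)) = num_queries N S"
    and "(\<And>s x. s \<in> {1..S} \<Longrightarrow> x \<in> Qc c s \<Longrightarrow> sum g x = sum g' x) \<Longrightarrow> i \<in> {1..N} \<Longrightarrow>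
      \<tau> \<in> {1..(if i = d c then H_par N S else S ^ (N - 1))} \<Longrightarrow>
      g (i, p c, P c i \<tau>) = (g' (i, p c, P c i \<tau>) :: bit)"
proof -
  note * = QSet1_queries[where a = "P c", OF S N d_mem[OF c] tau[OF c] _ Qc[OF c]]
  show "finite (Qc c s)" by (rule *(1)) (rule P_inj[OF c])
  have "x \<noteq> {} \<and> (\<forall>(i, j', \<tau>)\<in>x. j' = p c)" if "x \<in> Qc c s"
    using that by (rule *(2)[rotated]) (rule P_inj[OF c])
  then show "x \<in> Qc c s \<Longrightarrow> x \<noteq> {}" "x \<in> Qc c s \<Longrightarrow> (i, j, \<tau>) \<in> x \<Longrightarrow> j = p c" by blast+
  show "(\<Sum>s = 1..S. card (Qc c s)) = num_queries N S" by (rule *(3)) (rule P_inj[OF c])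
  show "g (i, p c, P c i \<tau>) = g' (i, p c, P c i \<tau>)"
    if "\<And>s x. s \<in> {1..S} \<Longrightarrow> x \<in> Qc c s \<Longrightarrow> sum g x = sum g' x" "i \<in> {1..N}"
      "\<tau> \<in> {1..(if i = d c then H_par N S else S ^ (N - 1))}"
    by (rule *(4)[OF P_inj[OF c] that])
qed

text \<open>A query is nonempty and all its symbols carry the subfile index \<open>p c\<close>, so
  injectivity of \<open>p\<close> makes the \<open>K\<close> query collections disjoint.\<close>

lemma sum_card_queries: "(\<Sum>s = 1..S. card (\<Union>c\<in>{1..K}. Qc c s)) = K * num_queries N S"
proof -
  have disj: "Qc c s \<inter> Qc c' s = {}" if cc: "c \<in> {1..K}" "c' \<in> {1..K}" "c \<noteq> c'" for c c' s
  proof (rule ccontr)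
    assume "Qc c s \<inter> Qc c' s \<noteq> {}"
    then obtain x where x: "x \<in> Qc c s" "x \<in> Qc c' s" by blast
    then obtain i j \<tau> where ij: "(i, j, \<tau>) \<in> x"
      using Qc_queries(2)[OF cc(1) x(1)] by (metis ex_in_conv surj_pair)
    have "j = p c" "j = p c'"
      using Qc_queries(3)[OF cc(1) x(1) ij] Qc_queries(3)[OF cc(2) x(2) ij] by simp_all
    then show False using cc(3) permutes_inj[OF p] by (simp add: inj_eq)
  qed
  have "card (\<Union>c\<in>{1..K}. Qc c s) = (\<Sum>c = 1..K. card (Qc c s))" for s
    by (intro card_UN_disjoint ballI impI finite_atLeastAtMost Qc_queries(1) disj)
  then have "(\<Sum>s = 1..S. card (\<Union>c\<in>{1..K}. Qc c s)) = (\<Sum>c = 1..K. \<Sum>s = 1..S. card (Qc c s))"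
    by (simp only: sum.swap[of _ "{1..K}"])
  also have "\<dots> = (\<Sum>c = 1..K. num_queries N S)"
    by (intro sum.cong refl Qc_queries(4))
  finally show ?thesis by simp
qed

lemma transmitted_bits_eq:
  "transmitted_bits N S K L (\<lambda>s. \<Union>c\<in>{1..K}. Qc c s) W = K * num_queries N S * block_size N S K L"
proof -
  have "transmitted_bits N S K L (\<lambda>s. \<Union>c\<in>{1..K}. Qc c s) W
      = (\<Sum>s = 1..S. card (\<Union>c\<in>{1..K}. Qc c s) * block_size N S K L)"
    unfolding transmitted_bits_def
  proof (rule sum.cong)
    fix s assume s: "s \<in> {1..S}"
    have "(\<Sum>x\<in>(\<Union>c\<in>{1..K}. Qc c s). length (answers N S K L (\<lambda>s. \<Union>c\<in>{1..K}. Qc c s) W s x))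
        = (\<Sum>x\<in>(\<Union>c\<in>{1..K}. Qc c s). block_size N S K L)"
      using s by (intro sum.cong) (auto simp: answers_def contents_def xor_sum_def)
    then show "(\<Sum>x\<in>(\<Union>c\<in>{1..K}. Qc c s). length (answers N S K L (\<lambda>s. \<Union>c\<in>{1..K}. Qc c s) W s x))
        = card (\<Union>c\<in>{1..K}. Qc c s) * block_size N S K L" by simp
  qed simp
  also have "\<dots> = (\<Sum>s = 1..S. card (\<Union>c\<in>{1..K}. Qc c s)) * block_size N S K L"
    by (simp only: sum_distrib_right)
  finally show ?thesis by (simp only: sum_card_queries)
qed

lemma demand_determined:
  assumes W: "W \<in> files N L" "W' \<in> files N L" and u: "u \<in> {1..K}"
    and ans: "answers N S K L (\<lambda>s. \<Union>c\<in>{1..K}. Qc c s) W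
      = answers N S K L (\<lambda>s. \<Union>c\<in>{1..K}. Qc c s) W'"
    and cache: "contents N S K L (cached N S K p u) W = contents N S K L (cached N S K p u) W'"
  shows "W (d u) = W' (d u)"
proof (rule file_determined_by_subsubfiles[OF _ _ dvd])
  show "length (W (d u)) = L" "length (W' (d u)) = L"
    using W d_mem[OF u] by (auto simp: files_def)
  fix j t b
  assume j: "j \<in> {1..K}" and t: "t \<in> {1..S ^ (N - 1)}" and b: "b < block_size N S K L"
  \<comment> \<open>At a fixed bit position the subsubfiles become single elements of the field
    \<open>bit\<close>, to which the decodability statement applies.\<close>
  define g g' where "g = (\<lambda>y. subsubfile N S K L W y ! b)" and "g' = (\<lambda>y. subsubfile N S K L W' y ! b)"
  obtain c where c: "c \<in> {1..K}" "j = p c"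
    using j permutes_image[OF p] by blast
  have sums: "sum g x = sum g' x" if s: "s \<in> {1..S}" and x: "x \<in> Qc c s" for s x
  proof -
    have x': "x \<in> (\<Union>c\<in>{1..K}. Qc c s)" using x c(1) by blast
    have "answers N S K L (\<lambda>s. \<Union>c\<in>{1..K}. Qc c s) V s x = xor_sum N S K L V x" for V
      unfolding answers_def contents_def restrict_apply using s x' by (simp only: if_True)
    then have "xor_sum N S K L W x = xor_sum N S K L W' x" using ans by metis
    then show ?thesis unfolding g_def g'_def using b by (rule xor_sum_eqD)
  qed
  have known: "g (i, j, P c i \<tau>) = g' (i, j, P c i \<tau>)"
    if "i \<in> {1..N}" "\<tau> \<in> {1..(if i = d c then H_par N S else S ^ (N - 1))}" for i \<tau>
    unfolding c(2) by (rule Qc_queries(5)[OF c(1) sums that])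
  have preimage: "\<exists>\<tau>\<in>{1..S ^ (N - 1)}. t = P c i \<tau>" if "i \<in> {1..N}" for i
    using t permutes_image[OF P_permutes[OF c(1) that]] by blast
  have other: "g (i, j, t) = g' (i, j, t)" if i: "i \<in> {1..N}" "i \<noteq> d c" for i
  proof -
    obtain \<tau> where "\<tau> \<in> {1..S ^ (N - 1)}" "t = P c i \<tau>" using preimage[OF i(1)] by blast
    then show ?thesis using known[OF i(1), of \<tau>] i(2) by simp
  qed
  have "g (d u, j, t) = g' (d u, j, t)"
  proof (cases "c = u")
    case False
    \<comment> \<open>Distinctness of demands enters here: in the run for another user, the file
      wanted by \<open>u\<close> is undesired and thus completely revealed.\<close>
    then have "d u \<noteq> d c" using inj_onD[OF d(2) _ u c(1)] by blast
    then show ?thesis using other d_mem[OF u] by blast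
  next
    case True
    show ?thesis
    proof (cases "t \<le> H_par N S")
      case True
      obtain \<tau> where \<tau>: "\<tau> \<in> {1..S ^ (N - 1)}" "t = P c (d c) \<tau>"
        using preimage[OF d_mem[OF c(1)]] by blast
      \<comment> \<open>The permutation fixes every position above \<open>H_par\<close>, so a value
        \<open>t\<close> up to \<open>H_par\<close> can only come from a position up to
        \<open>H_par\<close>, which the answers reveal.\<close>
      have "\<tau> \<le> H_par N S"
      proof (rule ccontr)
        assume "\<not> ?thesis"
        then have "\<tau> \<in> {H_par N S + 1..S ^ (N - 1)}" using \<tau>(1) by simp
        then have "P c (d c) \<tau> = \<tau>" using P c(1) unfolding valid_perms_def by blast
        then show False using \<tau>(2) \<open>t \<le> H_par N S\<close> \<open>\<not> \<tau> \<le> H_par N S\<close> by simp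
      qed
      then show ?thesis using known[OF d_mem[OF c(1)], of \<tau>] \<tau> \<open>c = u\<close> by simp
    next
      case False
      have pu: "p u \<in> {1..K}" "N \<ge> 1" using j c(2) True N by auto
      have "t \<in> {H_par N S + 1..S ^ (N - 1)}" using t False by simp
      then have mem: "file_sum N j t \<in> cached N S K p u"
        unfolding cached_eq[where p = p and u = u, OF pu(2,1)] c(2) True by blast
      then have "contents N S K L (cached N S K p u) V (file_sum N j t)
          = xor_sum N S K L V (file_sum N j t)" for V
        by (simp add: contents_def)
      then have "xor_sum N S K L W (file_sum N j t) = xor_sum N S K L W' (file_sum N j t)"
        using cache by metis
      then have eq: "sum g (file_sum N j t) = sum g' (file_sum N j t)"
        unfolding g_def g'_def using b by (rule xor_sum_eqD)
      have fin: "finite (file_sum N j t)" by (simp add: file_sum_def)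
      have du: "(d u, j, t) \<in> file_sum N j t" using d_mem[OF u] by (simp add: file_sum_def)
      \<comment> \<open>All other summands of the cached sum belong to files that are undesired in
        this run.\<close>
      have "g y = g' y" if y: "y \<in> file_sum N j t - {(d u, j, t)}" for y
      proof -
        obtain i where "i \<in> {1..N}" "y = (i, j, t)" using y by (auto simp: file_sum_def)
        then show ?thesis using y other[of i] True by blast
      qed
      then show ?thesis by (rule sum_eq_imp_term_eq[OF fin du eq])
    qed
  qed
  then show "subsubfile N S K L W (d u, j, t) ! b = subsubfile N S K L W' (d u, j, t) ! b"
    by (simp only: g_def g'_def)
qed

end

theorem theorem1:
  fixes S N K L :: nat and M :: real
    and d p :: "nat \<Rightarrow> nat"
    and P :: "nat \<Rightarrow> nat \<Rightarrow> nat \<Rightarrow> nat"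
    and tau :: "nat \<Rightarrow> tau_choice"
  assumes "S \<ge> 2" and "N = K" and "K \<ge> 2"
    and "L > 0" and "K * S ^ (N - 1) dvd L"
    and M: "M = (real N * real S ^ (N - 1) - real (num_queries N S)) / (real K * real S ^ (N - 1))"
    and demands: "d ` {1..K} \<subseteq> {1..N}" "inj_on d {1..K}"
    and p: "p permutes {1..K}"
    and P: "valid_perms N S K d P"
    and tau: "\<And>c. c \<in> {1..K} \<Longrightarrow> tau_rule (tau c)"
  shows "delivery N S K tau p P d \<noteq> {} \<and>
    (\<forall>W\<in>files N L. \<forall>u\<in>{1..K}. real (cache_bits N S K L p W u) = M * real L) \<and>
    (\<forall>Q\<in>delivery N S K tau p P d.
       (\<forall>u\<in>{1..K}. \<exists>dec. \<forall>W\<in>files N L.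
          dec (answers N S K L Q W) (contents N S K L (cached N S K p u) W) = W (d u)) \<and>
       (\<forall>W\<in>files N L.
          real (transmitted_bits N S K L Q W) / real L
            = real (num_queries N S) / real S ^ (N - 1)))"
proof -
  have N: "N \<ge> 2" "N \<ge> 1" using assms(2,3) by simp_all
  let ?B = "block_size N S K L"
  have L_nat: "L = K * S ^ (N - 1) * ?B" using assms(5) by (simp add: block_size_def)
  from arg_cong[OF L_nat, of real] have L: "real L = real K * real S ^ (N - 1) * real ?B"
    by (simp only: of_nat_mult of_nat_power)
  have pos: "real K > 0" "real S ^ (N - 1) > 0" using assms(1,3) by simp_all
  \<comment> \<open>\<open>L > 0\<close> excludes empty blocks, so the block size cancels in the
    rate.\<close>
  have B: "real ?B \<noteq> 0" using L_nat assms(4) by (metis mult_0_right of_nat_eq_0_iff less_irrefl)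
  have bits: "real (cache_bits N S K L p W u) = M * real L" if "u \<in> {1..K}" for W u
  proof -
    have "p u \<in> {1..K}" using that permutes_in_image[OF p] by simp
    from cache_bits_eq[of S N p u K L W, OF assms(1) N(2) this] show ?thesis
      unfolding M L using pos assms(1) by simp
  qed
  have "(\<forall>u\<in>{1..K}. \<exists>dec. \<forall>W\<in>files N L.
          dec (answers N S K L Q W) (contents N S K L (cached N S K p u) W) = W (d u)) \<and>
       (\<forall>W\<in>files N L.
          real (transmitted_bits N S K L Q W) / real L
            = real (num_queries N S) / real S ^ (N - 1))"
    if "Q \<in> delivery N S K tau p P d" for Q
  proof -
    obtain Qc where Q: "Q = (\<lambda>s. \<Union>c\<in>{1..K}. Qc c s)"
      and Qc: "\<And>c. c \<in> {1..K} \<Longrightarrow> Qc c \<in> QSet1 N S (tau c) (p c) (P c) (d c)"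
      using \<open>Q \<in> delivery N S K tau p P d\<close> unfolding delivery_def by blast
    note scheme = assms(1) N(1) assms(5) demands p P tau Qc
    have "\<exists>dec. \<forall>W\<in>files N L.
        dec (answers N S K L Q W) (contents N S K L (cached N S K p u) W) = W (d u)"
      if u: "u \<in> {1..K}" for u
      by (rule exists_decoder[where target = "\<lambda>W. W (d u)"])
        (rule demand_determined[where Qc = Qc and tau = tau, OF scheme _ _ u, folded Q]; assumption)
    moreover have "real (transmitted_bits N S K L Q W) / real L
        = real (num_queries N S) / real S ^ (N - 1)" for W
    proof -
      have "transmitted_bits N S K L Q W = K * num_queries N S * ?B"
        unfolding Q by (rule transmitted_bits_eq[where Qc = Qc and tau = tau, OF scheme])
      then show ?thesis using pos B unfolding L by simp
    qed
    ultimately show ?thesis by blast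
  qed
  then show ?thesis using delivery_nonempty[OF assms(1) demands(1)] bits by blast
qed

end
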